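(* Let $\rho:W_F\to\mathrm{GL}_2(\overline{\mathbb{Q}}_\ell)$ be a continuous, semisimple representation such that $\rho(W_F)\subset\mathrm{GL}_2(\mathcal{O}_K)$, whose associated Weil--Deligne representation is a special representation. Suppose (as may be assumed without loss of generality when studying $\overline\rho$) that $\rho$ is given by $$\rho(\Phi^k\tau)=\begin{pmatrix}\chi\omega(\Phi^k\tau) & \frac{a}{d}t_\ell(\tau)\chi\omega(\Phi^k\tau)+\frac{b}{d}\bigl(\chi(\Phi^k\tau)-\chi\omega(\Phi^k\tau)\bigr)\\ 0&\chi(\Phi^k\tau)\end{pmatrix}\qquad(k\in\mathbb{Z},\ \tau\in I_F),$$ where $\chi$ is a $1$-dimensional representation of $W_F$, $a,b,d\in K$ and $ad\neq0$. Then the reduction $\overline{\rho}$ is reducible. Further: (i) If $a/d\in\mathcal{O}_K^\times$, then $\overline{\rho}$ is indecomposable. (ii) If $q\not\equiv1\pmod{\ell}$ and $a/d\in\lambda$, then $\overline{\rho}$ decomposes as $\overline{\chi\omega}\oplus\overline{\chi}$. (iii) If $q\equiv1\pmod{\ell}$ and $a/d\in\lambda$, then $\overline{\rho}$ is decomposable (and decomposes as $\overline{\chi\omega}\oplus\overline{\chi}$) if and only if $v(b/d)\geq 1-ei$, where $e$ is the ramification index of $K/\mathbb{Q}_\ell$ and $i$ is the maximal nonnegative integer such that $q\equiv1\pmod{\ell^i}$.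
   Context: $p\neq\ell$ are odd primes. $F/\mathbb{Q}_p$ is a finite extension with residue field of order $q$, Weil group $W_F$ and inertia group $I_F$. $\Phi\in W_F$ is a fixed Frobenius element, and $\omega$ is the character of $W_F$ with $\omega(\Phi^k\tau)=q^{-k}$ for $k\in\mathbb{Z}$, $\tau\in I_F$. $t_\ell:I_F\to\mathbb{Z}_\ell$ is a fixed continuous surjective homomorphism; it satisfies $t_\ell(g\tau g^{-1})=\omega(g)t_\ell(\tau)$ for $g\in W_F,\tau\in I_F$. $K/\mathbb{Q}_\ell$ is a finite extension with ring of integers $\mathcal{O}_K$, maximal ideal $\lambda$, and normalized valuation $v$ (a uniformizer has valuation $1$). A bar denotes reduction modulo $\lambda$. The Weil--Deligne representation associated with a continuous $\rho:W_F\to \mathrm{GL}_2(\overline{\mathbb{Q}}_\ell)$ is $(\rho_\Phi,N_\rho)$, where $N_\rho$ is the unique nilpotent matrix with $\rho(\tau)=\exp(t_\ell(\tau)N_\rho)$ for $\tau$ in some open subgroup of $I_F$, and $\rho_\Phi(\Phi^k\tau)=\rho(\Phi^k\tau)\exp(-t_\ell(\tau)N_\rho)$. Here $\rho$ is called semisimple when $(\rho_\Phi,N_\rho)$ is $\Phi$-semisimple, i.e. when $\rho_\Phi$ is semisimple. It is special if it is isomorphic to $\left(\chi\omega\oplus\chi,\begin{pmatrix}0&1\\0&0\end{pmatrix}\right)$ for some $1$-dimensional representation $\chi$ of $W_F$. *)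

theory Defs
  imports
    "HOL-Analysis.Analysis"
    "HOL-Algebra.Group"
    "HOL-Number_Theory.Cong"
begin

section \<open>Subfields and finite extensions\<close>

definition is_subfield :: "'a::field set \<Rightarrow> bool" where
  "is_subfield K \<longleftrightarrow> 0 \<in> K \<and> 1 \<in> K \<and>
     (\<forall>x\<in>K. \<forall>y\<in>K. x - y \<in> K \<and> x * y \<in> K) \<and> (\<forall>x\<in>K. inverse x \<in> K)"

definition finite_extension :: "'a::field set \<Rightarrow> 'a set \<Rightarrow> bool" where
  "finite_extension E K \<longleftrightarrow> is_subfield E \<and> is_subfield K \<and> E \<subseteq> K \<and>
     (\<exists>B. finite B \<and> B \<subseteq> K \<and>
        (\<forall>x\<in>K. \<exists>c. (\<forall>b\<in>B. c b \<in> E) \<and> x = (\<Sum>b\<in>B. c b * b)))"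

definition algebraic_over :: "'a::field set \<Rightarrow> 'a \<Rightarrow> bool" where
  "algebraic_over E x \<longleftrightarrow> (\<exists>f. f \<noteq> 0 \<and> (\<forall>i. coeff f i \<in> E) \<and> poly f x = 0)"


section \<open>p-adic fields\<close>

definition padic_abs :: "nat \<Rightarrow> rat \<Rightarrow> real" where
  "padic_abs p r = (if r = 0 then 0 else
     real p powi (int (multiplicity (int p) (snd (quotient_of r)))
                  - int (multiplicity (int p) (fst (quotient_of r)))))"

definition abs_topology :: "('a::field \<Rightarrow> real) \<Rightarrow> 'a topology" where
  "abs_topology nrm = Metric_space.mtopology UNIV (\<lambda>x y. nrm (x - y))"

definition padic_numbers :: "('a::field_char_0 \<Rightarrow> real) \<Rightarrow> 'a set" where
  "padic_numbers nrm = abs_topology nrm closure_of \<rat>"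

text \<open>
  The whole type is an algebraic closure of the field of \<open>p\<close>-adic numbers: \<open>nrm\<close> is a
  non-archimedean absolute value extending the \<open>p\<close>-adic one on the rationals, the
  closure of the rationals is complete (hence is the completion of the rationals for the
  \<open>p\<close>-adic absolute value), and every element is algebraic over this closure.
  Finite extensions of the \<open>p\<close>-adic numbers are then subfields of the type.
\<close>

locale padic_closure =
  fixes p :: nat and nrm :: "'a::{alg_closed_field, field_char_0} \<Rightarrow> real"
  assumes prime_p: "prime p"
    and nrm_nonneg: "0 \<le> nrm x"
    and nrm_eq_0: "nrm x = 0 \<longleftrightarrow> x = 0"
    and nrm_mult: "nrm (x * y) = nrm x * nrm y"
    and nrm_add: "nrm (x + y) \<le> max (nrm x) (nrm y)"
    and nrm_rat: "nrm (of_rat r) = padic_abs p r"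
    and complete: "Metric_space.mcomplete (padic_numbers nrm) (\<lambda>x y. nrm (x - y))"
    and algebraic: "algebraic_over (padic_numbers nrm) x"

definition integers :: "('a::field \<Rightarrow> real) \<Rightarrow> 'a set \<Rightarrow> 'a set" where
  "integers nrm K = {x \<in> K. nrm x \<le> 1}"

definition max_ideal :: "('a::field \<Rightarrow> real) \<Rightarrow> 'a set \<Rightarrow> 'a set" where
  "max_ideal nrm K = {x \<in> K. nrm x < 1}"

definition unit_integers :: "('a::field \<Rightarrow> real) \<Rightarrow> 'a set \<Rightarrow> 'a set" where
  "unit_integers nrm K = {x \<in> integers nrm K. \<exists>y\<in>integers nrm K. x * y = 1}"

definition residue_order :: "('a::field \<Rightarrow> real) \<Rightarrow> 'a set \<Rightarrow> nat" where
  "residue_order nrm K = card (integers nrm K //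
     {(x, y). x \<in> integers nrm K \<and> y \<in> integers nrm K \<and> x - y \<in> max_ideal nrm K})"

definition uniformizer :: "('a::field \<Rightarrow> real) \<Rightarrow> 'a set \<Rightarrow> 'a \<Rightarrow> bool" where
  "uniformizer nrm K \<pi> \<longleftrightarrow> \<pi> \<noteq> 0 \<and> max_ideal nrm K = {\<pi> * x |x. x \<in> integers nrm K}"

definition normalized_val :: "('a::field \<Rightarrow> real) \<Rightarrow> 'a set \<Rightarrow> 'a \<Rightarrow> ereal" where
  "normalized_val nrm K x = (if x = 0 then \<infinity> else
     ereal (of_int (THE n. \<exists>\<pi> u. uniformizer nrm K \<pi> \<and> u \<in> unit_integers nrm K \<and>
                              x = u * \<pi> powi n)))"

text \<open>The exponent \<open>e\<close> in the factorization of the ideal generated by \<open>l\<close> as the \<open>e\<close>-th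
  power of the maximal ideal.\<close>

definition ramification_index :: "nat \<Rightarrow> ('a::field \<Rightarrow> real) \<Rightarrow> 'a set \<Rightarrow> nat" where
  "ramification_index l nrm K =
     (THE e. \<exists>\<pi> u. uniformizer nrm K \<pi> \<and> u \<in> unit_integers nrm K \<and> of_nat l = u * \<pi> ^ e)"

text \<open>A field \<open>'k\<close> with such a map is the residue field of \<open>K\<close>, up to a unique isomorphism
  compatible with the reduction maps.\<close>

definition reduction_map :: "('a::field \<Rightarrow> real) \<Rightarrow> 'a set \<Rightarrow> ('a \<Rightarrow> 'k::field) \<Rightarrow> bool" where
  "reduction_map nrm K red \<longleftrightarrow> red 1 = 1 \<and>
     (\<forall>x\<in>integers nrm K. \<forall>y\<in>integers nrm K.
        red (x + y) = red x + red y \<and> red (x * y) = red x * red y) \<and>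
     red ` integers nrm K = UNIV \<and>
     (\<forall>x\<in>integers nrm K. red x = 0 \<longleftrightarrow> x \<in> max_ideal nrm K)"


section \<open>The Weil group\<close>

definition galois :: "'a::field set \<Rightarrow> ('a \<Rightarrow> 'a) set" where
  "galois F = {\<sigma>. bij \<sigma> \<and> (\<forall>x y. \<sigma> (x + y) = \<sigma> x + \<sigma> y \<and> \<sigma> (x * y) = \<sigma> x * \<sigma> y) \<and>
                  (\<forall>x\<in>F. \<sigma> x = x)}"

definition residually_equal :: "('a::field \<Rightarrow> real) \<Rightarrow> ('a \<Rightarrow> 'a) \<Rightarrow> ('a \<Rightarrow> 'a) \<Rightarrow> bool" where
  "residually_equal nrm f g \<longleftrightarrow> (\<forall>x\<in>integers nrm UNIV. f x - g x \<in> max_ideal nrm UNIV)"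

definition inertia :: "('a::field \<Rightarrow> real) \<Rightarrow> 'a set \<Rightarrow> ('a \<Rightarrow> 'a) set" where
  "inertia nrm F = {\<sigma> \<in> galois F. residually_equal nrm \<sigma> (\<lambda>x. x)}"

text \<open>The automorphisms inducing an integral power (the \<open>n\<close>-th or the \<open>-n\<close>-th) of
  \<open>x \<mapsto> x ^ q\<close> on the residue field of the algebraic closure.\<close>

definition weil_set :: "('a::field \<Rightarrow> real) \<Rightarrow> 'a set \<Rightarrow> ('a \<Rightarrow> 'a) set" where
  "weil_set nrm F = {\<sigma> \<in> galois F. \<exists>n::nat.
     residually_equal nrm \<sigma> (\<lambda>x. x ^ (residue_order nrm F ^ n)) \<or>
     residually_equal nrm (\<lambda>x. \<sigma> x ^ (residue_order nrm F ^ n)) (\<lambda>x. x)}"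

definition weil_group :: "('a::field \<Rightarrow> real) \<Rightarrow> 'a set \<Rightarrow> ('a \<Rightarrow> 'a) monoid" where
  "weil_group nrm F = \<lparr>carrier = weil_set nrm F, monoid.mult = (\<circ>), one = id\<rparr>"

text \<open>Frobenius elements are geometric: they induce the inverse of \<open>x \<mapsto> x ^ q\<close>.  This is the
  normalization for which \<open>\<omega>\<close> with \<open>\<omega> \<Phi> = 1/q\<close> is the cyclotomic character, as required by
  \<open>t (g \<tau> g\<^sup>-\<^sup>1) = \<omega> g * t \<tau>\<close>.\<close>

definition frobenius_element :: "('a::field \<Rightarrow> real) \<Rightarrow> 'a set \<Rightarrow> ('a \<Rightarrow> 'a) \<Rightarrow> bool" where
  "frobenius_element nrm F \<Phi> \<longleftrightarrow> \<Phi> \<in> galois F \<and>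
     residually_equal nrm (\<lambda>x. \<Phi> x ^ residue_order nrm F) (\<lambda>x. x)"

text \<open>Inertia with its Krull topology is an open subgroup: the cosets of its intersections
  with the absolute Galois groups of finite extensions of \<open>F\<close> form a base.\<close>

definition weil_topology :: "('a::field \<Rightarrow> real) \<Rightarrow> 'a set \<Rightarrow> ('a \<Rightarrow> 'a) topology" where
  "weil_topology nrm F = topology_generated_by
     {(\<lambda>h. g \<circ> h) ` (inertia nrm F \<inter> galois E) |g E.
        g \<in> weil_set nrm F \<and> finite_extension F E}"

definition tame_hom ::
  "('a::field \<Rightarrow> real) \<Rightarrow> 'a set \<Rightarrow> ('b::field_char_0 \<Rightarrow> real) \<Rightarrow> (('a \<Rightarrow> 'a) \<Rightarrow> 'b) \<Rightarrow> bool" where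
  "tame_hom nrm F nrml t \<longleftrightarrow>
     (\<forall>\<sigma>\<in>inertia nrm F. \<forall>\<tau>\<in>inertia nrm F. t (\<sigma> \<circ> \<tau>) = t \<sigma> + t \<tau>) \<and>
     t ` inertia nrm F = integers nrml (padic_numbers nrml) \<and>
     continuous_map (subtopology (weil_topology nrm F) (inertia nrm F)) (abs_topology nrml) t"


section \<open>Representations\<close>

definition GL :: "('k::field ^ 'n ^ 'n) monoid" where
  "GL = \<lparr>carrier = {A. invertible A}, monoid.mult = (**), one = mat 1\<rparr>"

definition GL_over :: "'k::field set \<Rightarrow> ('k ^ 'n ^ 'n) set" where
  "GL_over R = {A. (\<forall>i j. A $ i $ j \<in> R) \<and>
     (\<exists>B. (\<forall>i j. B $ i $ j \<in> R) \<and> A ** B = mat 1 \<and> B ** A = mat 1)}"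

definition invariant_subspace :: "'g set \<Rightarrow> ('g \<Rightarrow> 'k::field ^ 'n ^ 'n) \<Rightarrow> ('k ^ 'n) set \<Rightarrow> bool" where
  "invariant_subspace G r W \<longleftrightarrow> vec.subspace W \<and> (\<forall>g\<in>G. \<forall>w\<in>W. r g *v w \<in> W)"

definition complementary :: "('k::field ^ 'n) set \<Rightarrow> ('k ^ 'n) set \<Rightarrow> bool" where
  "complementary U W \<longleftrightarrow> U \<inter> W = {0} \<and> {u + w |u w. u \<in> U \<and> w \<in> W} = UNIV"

definition reducible_rep :: "'g set \<Rightarrow> ('g \<Rightarrow> 'k::field ^ 'n ^ 'n) \<Rightarrow> bool" where
  "reducible_rep G r \<longleftrightarrow> (\<exists>W. invariant_subspace G r W \<and> W \<noteq> {0} \<and> W \<noteq> UNIV)"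

definition decomposable_rep :: "'g set \<Rightarrow> ('g \<Rightarrow> 'k::field ^ 'n ^ 'n) \<Rightarrow> bool" where
  "decomposable_rep G r \<longleftrightarrow>
     (\<exists>U W. invariant_subspace G r U \<and> invariant_subspace G r W \<and>
            U \<noteq> {0} \<and> W \<noteq> {0} \<and> complementary U W)"

definition semisimple_rep :: "'g set \<Rightarrow> ('g \<Rightarrow> 'k::field ^ 'n ^ 'n) \<Rightarrow> bool" where
  "semisimple_rep G r \<longleftrightarrow>
     (\<forall>U. invariant_subspace G r U \<longrightarrow> (\<exists>W. invariant_subspace G r W \<and> complementary U W))"

definition isomorphic_reps ::
  "'g set \<Rightarrow> ('g \<Rightarrow> 'k::field ^ 'n ^ 'n) \<Rightarrow> ('g \<Rightarrow> 'k ^ 'n ^ 'n) \<Rightarrow> bool" where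
  "isomorphic_reps G r s \<longleftrightarrow> (\<exists>P. invertible P \<and> (\<forall>g\<in>G. P ** r g = s g ** P))"

definition mat2 :: "'k \<Rightarrow> 'k \<Rightarrow> 'k \<Rightarrow> 'k \<Rightarrow> 'k::zero ^ 2 ^ 2" where
  "mat2 a b c d = vector [vector [a, b], vector [c, d]]"

definition char_sum :: "('g \<Rightarrow> 'k) \<Rightarrow> ('g \<Rightarrow> 'k) \<Rightarrow> 'g \<Rightarrow> 'k::field ^ 2 ^ 2" where
  "char_sum chi psi g = mat2 (chi g) 0 0 (psi g)"

definition reduce_rep :: "('b \<Rightarrow> 'k) \<Rightarrow> ('g \<Rightarrow> 'b ^ 'n ^ 'n) \<Rightarrow> 'g \<Rightarrow> 'k ^ 'n ^ 'n" where
  "reduce_rep red r g = (\<chi> i j. red (r g $ i $ j))"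

definition weil_representation ::
  "('a::field \<Rightarrow> real) \<Rightarrow> 'a set \<Rightarrow> ('b::field \<Rightarrow> real) \<Rightarrow> (('a \<Rightarrow> 'a) \<Rightarrow> 'b ^ 'n ^ 'n) \<Rightarrow> bool" where
  "weil_representation nrm F nrml \<rho> \<longleftrightarrow> \<rho> \<in> hom (weil_group nrm F) GL \<and>
     (\<forall>i j. continuous_map (weil_topology nrm F) (abs_topology nrml) (\<lambda>g. \<rho> g $ i $ j))"

definition weil_character ::
  "('a::field \<Rightarrow> real) \<Rightarrow> 'a set \<Rightarrow> ('b::field \<Rightarrow> real) \<Rightarrow> (('a \<Rightarrow> 'a) \<Rightarrow> 'b) \<Rightarrow> bool" where
  "weil_character nrm F nrml chi \<longleftrightarrow>
     (\<forall>g\<in>weil_set nrm F. chi g \<noteq> 0) \<and>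
     (\<forall>g\<in>weil_set nrm F. \<forall>h\<in>weil_set nrm F. chi (g \<circ> h) = chi g * chi h) \<and>
     continuous_map (weil_topology nrm F) (abs_topology nrml) chi"


section \<open>Weil--Deligne representations\<close>

definition mat_power :: "'k::comm_ring_1 ^ 'n ^ 'n \<Rightarrow> nat \<Rightarrow> 'k ^ 'n ^ 'n" where
  "mat_power A m = (((**) A) ^^ m) (mat 1)"

definition nilpotent_matrix :: "'k::comm_ring_1 ^ 'n ^ 'n \<Rightarrow> bool" where
  "nilpotent_matrix A \<longleftrightarrow> (\<exists>m. mat_power A m = 0)"

text \<open>The exponential of a nilpotent matrix; its powers from the dimension on vanish.\<close>

definition nilpotent_exp :: "'k::field_char_0 ^ 'n ^ 'n \<Rightarrow> 'k ^ 'n ^ 'n" where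
  "nilpotent_exp A = (\<Sum>m<CARD('n). mat (1 / fact m) ** mat_power A m)"

text \<open>\<open>(r, N)\<close> is the Weil--Deligne representation associated with \<open>\<rho>\<close>; \<open>mat c ** N\<close> is the
  scalar multiple \<open>c N\<close>.\<close>

definition associated_weil_deligne ::
  "('a::field \<Rightarrow> real) \<Rightarrow> 'a set \<Rightarrow> ('b::field_char_0 \<Rightarrow> real) \<Rightarrow> ('a \<Rightarrow> 'a) \<Rightarrow> (('a \<Rightarrow> 'a) \<Rightarrow> 'b) \<Rightarrow>
   (('a \<Rightarrow> 'a) \<Rightarrow> 'b ^ 'n ^ 'n) \<Rightarrow> (('a \<Rightarrow> 'a) \<Rightarrow> 'b ^ 'n ^ 'n) \<Rightarrow> 'b ^ 'n ^ 'n \<Rightarrow> bool" where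
  "associated_weil_deligne nrm F nrml \<Phi> t \<rho> r N \<longleftrightarrow>
     nilpotent_matrix N \<and>
     (\<exists>U. U \<subseteq> inertia nrm F \<and> subgroup U (weil_group nrm F) \<and>
          openin (subtopology (weil_topology nrm F) (inertia nrm F)) U \<and>
          (\<forall>\<tau>\<in>U. \<rho> \<tau> = nilpotent_exp (mat (t \<tau>) ** N))) \<and>
     (\<forall>k::int. \<forall>\<tau>\<in>inertia nrm F.
        r (\<Phi> [^]\<^bsub>weil_group nrm F\<^esub> k \<circ> \<tau>) =
          \<rho> (\<Phi> [^]\<^bsub>weil_group nrm F\<^esub> k \<circ> \<tau>) ** nilpotent_exp (mat (- t \<tau>) ** N))"

definition special_weil_deligne ::
  "('a::field \<Rightarrow> real) \<Rightarrow> 'a set \<Rightarrow> ('b::field_char_0 \<Rightarrow> real) \<Rightarrow> (('a \<Rightarrow> 'a) \<Rightarrow> 'b) \<Rightarrow>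
   (('a \<Rightarrow> 'a) \<Rightarrow> 'b ^ 2 ^ 2) \<Rightarrow> 'b ^ 2 ^ 2 \<Rightarrow> bool" where
  "special_weil_deligne nrm F nrml \<omega> r N \<longleftrightarrow>
     (\<exists>chi P. weil_character nrm F nrml chi \<and> invertible P \<and>
        (\<forall>g\<in>weil_set nrm F. P ** r g = char_sum (\<lambda>h. chi h * \<omega> h) chi g ** P) \<and>
        P ** N = mat2 0 1 0 0 ** P)"

end

theory Submission
  imports Defs
begin

text \<open>
  The characters \<open>\<chi>\<close> and \<open>\<chi>\<omega>\<close> have unit values, being the diagonal of integral triangular
  matrices with integral inverse.  A \<open>\<tau>\<close> in inertia with \<open>t(\<tau>) = 1\<close> has a
  non-diagonal unipotent reduction up to a scalar when \<open>a/d\<close> is a unit.  When \<open>a/d\<close> is not a unit,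
  the off-diagonal entry reduces to that of \<open>(b/d) (\<chi> - \<chi>\<omega>)\<close>.  If \<open>q \<noteq> 1\<close> modulo \<open>l\<close>, integrality at \<open>\<Phi>\<close> forces
  \<open>b/d\<close> to be integral, so a unipotent change of basis over the residue field splits the
  reduction.  If \<open>q = 1\<close> modulo \<open>l\<close>, the reduced diagonal is scalar, so the reduction decomposes iff
  this entry vanishes, and since \<open>1 - \<omega>\<close> is always divisible by \<open>1 - \<omega>(\<Phi>)\<close>, whose absolute value is
  that of \<open>l\<^sup>i\<close>, this says that \<open>(b/d) l\<^sup>i\<close> is in the maximal ideal.

  The valuation on \<open>K\<close> is discrete: a linear relation between the powers \<open>x\<^sup>j\<close>, \<open>j \<le> n\<close>, over the
  \<open>l\<close>-adic numbers, where \<open>n\<close> bounds the degree of \<open>K\<close>, has two terms of equal absolute value, so some \<open>\<bar>x\<bar>\<^sup>j\<close> with \<open>0 < j \<le> n\<close> is an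
  integral power of \<open>l\<close>.
\<close>

section \<open>Subfields and ultrametric absolute values\<close>

lemma is_subfieldD:
  assumes "is_subfield K"
  shows is_subfield_0: "0 \<in> K" and is_subfield_1: "1 \<in> K"
    and is_subfield_diff: "\<And>x y. x \<in> K \<Longrightarrow> y \<in> K \<Longrightarrow> x - y \<in> K"
    and is_subfield_mult: "\<And>x y. x \<in> K \<Longrightarrow> y \<in> K \<Longrightarrow> x * y \<in> K"
    and is_subfield_inverse: "\<And>x. x \<in> K \<Longrightarrow> inverse x \<in> K"
  using assms by (auto simp: is_subfield_def)

lemma is_subfield_divide: "is_subfield K \<Longrightarrow> x \<in> K \<Longrightarrow> y \<in> K \<Longrightarrow> x / y \<in> K"
  by (simp add: divide_inverse is_subfield_mult is_subfield_inverse)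

lemma is_subfield_uminus: "is_subfield K \<Longrightarrow> x \<in> K \<Longrightarrow> - x \<in> K"
  using is_subfield_diff[of K 0 x] by (simp add: is_subfield_0)

lemma is_subfield_add: "is_subfield K \<Longrightarrow> x \<in> K \<Longrightarrow> y \<in> K \<Longrightarrow> x + y \<in> K"
  using is_subfield_diff[of K x "- y"] by (simp add: is_subfield_uminus)

lemma is_subfield_sum:
  "is_subfield K \<Longrightarrow> (\<And>j. j \<in> J \<Longrightarrow> f j \<in> K) \<Longrightarrow> sum f J \<in> K"
  by (induction J rule: infinite_finite_induct) (auto simp: is_subfield_0 is_subfield_add)

lemma is_subfield_power: "is_subfield K \<Longrightarrow> x \<in> K \<Longrightarrow> x ^ n \<in> K"
  by (induction n) (auto simp: is_subfield_1 is_subfield_mult)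

lemma is_subfield_power_int: "is_subfield K \<Longrightarrow> x \<in> K \<Longrightarrow> x powi n \<in> K"
  by (simp add: power_int_def is_subfield_power is_subfield_inverse)

lemma is_subfield_of_nat: "is_subfield K \<Longrightarrow> of_nat n \<in> K"
  by (induction n) (auto simp: is_subfield_0 is_subfield_1 is_subfield_add)

text \<open>Gaussian elimination over a subfield given as a set, by induction on the generators
  \<open>B\<close>: if some \<open>x j0\<close> involves the generator \<open>b\<close>, it serves
  as pivot and removes \<open>b\<close> from all the others, at the cost of one index. The family
  \<open>B\<close> only has to span.\<close>

lemma linear_dependence:
  fixes E :: "'a::field set"
  assumes E: "is_subfield E" and "finite B" "finite J" "card B < card J"
    and "\<And>j. j \<in> J \<Longrightarrow> \<exists>c. (\<forall>b\<in>B. c b \<in> E) \<and> x j = (\<Sum>b\<in>B. c b * b)"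
  shows "\<exists>d. (\<forall>j\<in>J. d j \<in> E) \<and> (\<exists>j\<in>J. d j \<noteq> 0) \<and> (\<Sum>j\<in>J. d j * x j) = 0"
  using assms(2-)
proof (induction B arbitrary: J x rule: finite_induct)
  case empty
  then show ?case
    by (intro exI[of _ "\<lambda>_. 1"]) (auto simp: is_subfield_1[OF E] card_gt_0_iff)
next
  case (insert b B)
  have "\<forall>j\<in>J. \<exists>c. (\<forall>b\<in>insert b B. c b \<in> E) \<and> x j = (\<Sum>b\<in>insert b B. c b * b)"
    using insert.prems(3) by blast
  from bchoice[OF this] obtain c where c: "\<And>j a. j \<in> J \<Longrightarrow> a \<in> insert b B \<Longrightarrow> c j a \<in> E"
    and x: "\<And>j. j \<in> J \<Longrightarrow> x j = (\<Sum>a\<in>insert b B. c j a * a)"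
    by auto
  show ?case
  proof (cases "\<forall>j\<in>J. c j b = 0")
    case True
    have "\<exists>c. (\<forall>b\<in>B. c b \<in> E) \<and> x j = (\<Sum>b\<in>B. c b * b)" if "j \<in> J" for j
      using c x True that insert.hyps by (intro exI[of _ "c j"]) auto
    then show ?thesis
      using insert by simp
  next
    case False
    then obtain j0 where j0: "j0 \<in> J" "c j0 b \<noteq> 0" by blast
    define m where "m j = c j b / c j0 b" for j
    have m: "m j \<in> E" if "j \<in> J" for j
      using that j0 c by (simp add: m_def is_subfield_divide[OF E])
    define y where "y j = x j - m j * x j0" for j
    have "\<exists>c. (\<forall>b\<in>B. c b \<in> E) \<and> y j = (\<Sum>b\<in>B. c b * b)" if "j \<in> J - {j0}" for j
    proof (intro exI conjI ballI)
      show "c j a - m j * c j0 a \<in> E" if "a \<in> B" for a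
        using that \<open>j \<in> J - {j0}\<close> j0 c m
        by (auto intro!: is_subfield_diff[OF E] is_subfield_mult[OF E])
      have "y j = (\<Sum>a\<in>insert b B. (c j a - m j * c j0 a) * a)"
        using that j0 x by (simp add: y_def sum_subtractf sum_distrib_left left_diff_distrib mult.assoc)
      also have "\<dots> = (\<Sum>a\<in>B. (c j a - m j * c j0 a) * a)"
        using insert.hyps j0 by (simp add: m_def)
      finally show "y j = (\<Sum>a\<in>B. (c j a - m j * c j0 a) * a)" .
    qed
    moreover have "finite (J - {j0})" "card B < card (J - {j0})"
      using insert.prems insert.hyps j0 by auto
    ultimately obtain d where d: "\<And>j. j \<in> J - {j0} \<Longrightarrow> d j \<in> E" "\<exists>j\<in>J - {j0}. d j \<noteq> 0"
      "(\<Sum>j\<in>J - {j0}. d j * y j) = 0"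
      using insert.IH[of "J - {j0}" y] by blast
    \<comment> \<open>The pivot coefficient collects all the multiples \<open>m j\<close> of
      \<open>x j0\<close> subtracted in \<open>y j\<close>, so that the relation among the
      \<open>y j\<close> becomes one among the \<open>x j\<close>.\<close>
    define d' where "d' j = (if j = j0 then - (\<Sum>j\<in>J - {j0}. d j * m j) else d j)" for j
    have "(\<Sum>j\<in>J. d' j * x j) = d' j0 * x j0 + (\<Sum>j\<in>J - {j0}. d' j * x j)"
      using insert.prems j0 by (simp add: sum.remove)
    also have "(\<Sum>j\<in>J - {j0}. d' j * x j) = (\<Sum>j\<in>J - {j0}. d j * x j)"
      by (intro sum.cong) (auto simp: d'_def)
    also have "d' j0 * x j0 + \<dots> = (\<Sum>j\<in>J - {j0}. d j * y j)"
      by (simp add: d'_def y_def right_diff_distrib sum_subtractf sum_distrib_right mult.assoc)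
    finally have "(\<Sum>j\<in>J. d' j * x j) = 0" using d by simp
    moreover have "\<forall>j\<in>J. d' j \<in> E"
      using d m unfolding d'_def
      by (auto intro!: is_subfield_uminus[OF E] is_subfield_sum[OF E] is_subfield_mult[OF E])
    moreover have "\<exists>j\<in>J. d' j \<noteq> 0"
      using d(2) by (auto simp: d'_def)
    ultimately show ?thesis by blast
  qed
qed

section \<open>Arithmetic of the non-archimedean absolute value\<close>

context padic_closure
begin

lemma nrm_0 [simp]: "nrm 0 = 0"
  by (simp add: nrm_eq_0)

lemma nrm_pos: "x \<noteq> 0 \<Longrightarrow> 0 < nrm x"
  using nrm_nonneg[of x] nrm_eq_0[of x] by linarith

lemma nrm_1 [simp]: "nrm 1 = 1"
  using nrm_mult[of 1 1] nrm_pos[of 1] by simp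

lemma nrm_minus [simp]: "nrm (- x) = nrm x"
proof -
  have "nrm (- 1) * nrm (- 1) = 1"
    using nrm_mult[of "- 1" "- 1"] by simp
  then have "nrm (- 1) = 1"
    using nrm_nonneg[of "- 1"] by (auto simp: square_eq_1_iff)
  then show ?thesis using nrm_mult[of "- 1" x] by simp
qed

lemma nrm_minus_commute: "nrm (x - y) = nrm (y - x)"
  using nrm_minus[of "x - y"] by simp

lemma nrm_diff: "nrm (x - y) \<le> max (nrm x) (nrm y)"
  using nrm_add[of x "- y"] by simp

lemma nrm_power: "nrm (x ^ n) = nrm x ^ n"
  by (induction n) (auto simp: nrm_mult)

lemma nrm_inverse: "nrm (inverse x) = inverse (nrm x)"
proof (cases "x = 0")
  case False
  then have "nrm x * nrm (inverse x) = 1"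
    using nrm_mult[of x "inverse x"] by simp
  then show ?thesis by (simp add: inverse_unique)
qed simp

lemma nrm_divide: "nrm (x / y) = nrm x / nrm y"
  by (simp add: divide_inverse nrm_mult nrm_inverse)

lemma nrm_power_int: "nrm (x powi n) = nrm x powi n"
  by (simp add: power_int_def nrm_power nrm_inverse)

lemma nrm_add_less: "nrm x < r \<Longrightarrow> nrm y < r \<Longrightarrow> nrm (x + y) < r"
  using nrm_add[of x y] by linarith

lemma nrm_diff_trans: "nrm (x - y) < r \<Longrightarrow> nrm (y - z) < r \<Longrightarrow> nrm (x - z) < r"
  using nrm_add_less[of "x - y" r "y - z"] by simp

lemma nrm_mult_less: "nrm x \<le> 1 \<Longrightarrow> nrm y < r \<Longrightarrow> nrm (x * y) < r"
  using mult_left_le_one_le[of "nrm y" "nrm x"] nrm_nonneg[of x] nrm_nonneg[of y]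
  by (simp add: nrm_mult)

lemma nrm_sum_less: "0 < r \<Longrightarrow> (\<And>j. j \<in> J \<Longrightarrow> nrm (f j) < r) \<Longrightarrow> nrm (sum f J) < r"
  by (induction J rule: infinite_finite_induct) (auto intro: nrm_add_less)

text \<open>A term strictly larger than all others cannot be cancelled by them in an ultrametric, so
  in a vanishing sum the maximal absolute value is attained twice. The nonzero term
  \<open>f j\<close> makes this maximum positive.\<close>

lemma sum_eq_0_nrm_eq:
  assumes "finite J" "sum f J = 0" "j \<in> J" "f j \<noteq> 0"
  shows "\<exists>i\<in>J. \<exists>k\<in>J. i \<noteq> k \<and> f i \<noteq> 0 \<and> nrm (f i) = nrm (f k)"
proof -
  obtain i where i: "i \<in> J" "\<And>k. k \<in> J \<Longrightarrow> nrm (f k) \<le> nrm (f i)"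
    using assms(1,3) Max_in[of "(\<lambda>i. nrm (f i)) ` J"] Max_ge[of "(\<lambda>i. nrm (f i)) ` J"]
    by fastforce
  have pos: "0 < nrm (f i)"
    using i(2)[OF assms(3)] nrm_pos[OF assms(4)] by linarith
  have "f i = - sum f (J - {i})"
    using assms(1,2) i(1) by (simp add: sum.remove[of J i] eq_neg_iff_add_eq_0)
  then have "\<not> nrm (sum f (J - {i})) < nrm (f i)"
    by (metis nrm_minus less_irrefl)
  then obtain k where k: "k \<in> J - {i}" "\<not> nrm (f k) < nrm (f i)"
    using nrm_sum_less[OF pos, of "J - {i}" f] by blast
  then show ?thesis
    using i k pos by (intro bexI[of _ i] bexI[of _ k]) (auto simp: not_less order_antisym)
qed


lemma nrm_of_nat_not_dvd:
  assumes "\<not> p dvd n"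
  shows "nrm (of_nat n) = 1"
proof -
  have "\<not> int p dvd int n" and "n \<noteq> 0" using assms by (auto intro: ccontr)
  then show ?thesis
    using nrm_rat[of "of_nat n"] by (simp add: padic_abs_def not_dvd_imp_multiplicity_0)
qed

lemma nrm_of_nat_self: "nrm (of_nat p) = 1 / real p"
proof -
  have "multiplicity (int p) (int p) = 1"
    using prime_gt_1_nat[OF prime_p] by (intro multiplicity_self) auto
  then show ?thesis
    using nrm_rat[of "of_nat p"] prime_gt_0_nat[OF prime_p]
    by (simp add: padic_abs_def power_int_minus field_simps)
qed

end

section \<open>Discreteness of the valuation\<close>

context padic_closure
begin

lemma Metric_space_nrm: "Metric_space UNIV (\<lambda>x y. nrm (x - y))"
proof
  fix x y z
  show "nrm (x - z) \<le> nrm (x - y) + nrm (y - z)"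
    using nrm_add[of "x - y" "y - z"] nrm_nonneg[of "x - y"] nrm_nonneg[of "y - z"] by simp
qed (auto simp: nrm_nonneg nrm_eq_0 intro: nrm_minus_commute)

text \<open>A rational number closer to \<open>x\<close> than |x| has the same absolute value as
  \<open>x\<close>, so closing up the rationals adds no new values.\<close>

lemma nrm_padic_numbers:
  assumes "x \<in> padic_numbers nrm" "x \<noteq> 0"
  shows "\<exists>k::int. nrm x = real p powi k"
proof -
  interpret Metric_space UNIV "\<lambda>x y. nrm (x - y)" by (rule Metric_space_nrm)
  have "\<exists>y\<in>\<rat>. nrm (x - y) < nrm x"
    using assms nrm_pos[of x] by (auto simp: padic_numbers_def abs_topology_def metric_closure_of)
  then obtain r where r: "nrm (x - of_rat r) < nrm x" by (auto elim!: Rats_cases)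
  have "nrm x \<le> nrm (of_rat r)"
    using nrm_add[of "x - of_rat r" "of_rat r"] r by simp
  moreover have "nrm (of_rat r) \<le> nrm x"
    using nrm_diff[of x "x - of_rat r"] r by simp
  ultimately have "nrm x = padic_abs p r" by (simp add: nrm_rat)
  then show ?thesis
    using nrm_pos[OF assms(2)] by (auto simp: padic_abs_def split: if_splits)
qed

end

section \<open>Finite extensions of the p-adic numbers: value group, uniformizers, normalized
  valuation\<close>

locale local_field = padic_closure p nrm
  for p :: nat and nrm :: "'a::{alg_closed_field, field_char_0} \<Rightarrow> real" +
  fixes K :: "'a set"
  assumes finite_ext: "finite_extension (padic_numbers nrm) K"
begin

lemma subfield_K: "is_subfield K" and subfield_padic: "is_subfield (padic_numbers nrm)"
  and padic_subset: "padic_numbers nrm \<subseteq> K"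
  using finite_ext by (auto simp: finite_extension_def)

text \<open>Among the powers of \<open>x\<close> up to \<open>card B\<close> there is a linear
  relation, and two of its terms have equal absolute value; their quotient makes |x|^(j - i) the
  absolute value of a p-adic number. The factorial of \<open>card B\<close> is a multiple of every
  such j - i, which gives one exponent for all \<open>x\<close>.\<close>

lemma value_group_discrete:
  "\<exists>m>0. \<forall>x\<in>K - {0}. \<exists>k::int. nrm x ^ m = real p powi k"
proof -
  obtain B where B: "finite B"
    "\<And>x. x \<in> K \<Longrightarrow> \<exists>c. (\<forall>b\<in>B. c b \<in> padic_numbers nrm) \<and> x = (\<Sum>b\<in>B. c b * b)"
    using finite_ext unfolding finite_extension_def by blast
  have "\<exists>k::int. nrm x ^ fact (card B) = real p powi k" if x: "x \<in> K" "x \<noteq> 0" for x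
  proof -
    obtain d where d: "\<And>j. j \<le> card B \<Longrightarrow> d j \<in> padic_numbers nrm" "\<exists>j\<in>{..card B}. d j \<noteq> 0"
      "(\<Sum>j\<le>card B. d j * x ^ j) = 0"
      using linear_dependence[OF subfield_padic B(1), of "{..card B}" "\<lambda>j. x ^ j"]
        B(2)[OF is_subfield_power[OF subfield_K x(1)]] by auto
    obtain i0 where "i0 \<in> {..card B}" "d i0 * x ^ i0 \<noteq> 0"
      using d(2) x(2) by auto
    from sum_eq_0_nrm_eq[OF _ d(3) this]
    obtain i j where ij: "i \<le> card B" "j \<le> card B" "i \<noteq> j" "d i \<noteq> 0"
      "nrm (d i) * nrm x ^ i = nrm (d j) * nrm x ^ j"
      by (auto simp: nrm_mult nrm_power)
    have *: "\<exists>k::int. nrm x ^ fact (card B) = real p powi k"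
      if ij: "i \<le> card B" "j \<le> card B" "i < j" "d i \<noteq> 0" "d j \<noteq> 0"
        "nrm (d i) * nrm x ^ i = nrm (d j) * nrm x ^ j" for i j
    proof -
      have pos: "nrm x > 0" "nrm (d j) > 0" using x ij nrm_pos by auto
      have "nrm (d i) * nrm x ^ i = (nrm (d j) * nrm x ^ (j - i)) * nrm x ^ i"
        using ij by (simp flip: power_add)
      then have eq: "nrm x ^ (j - i) = nrm (d i) / nrm (d j)"
        using pos by (simp add: field_simps)
      have "nrm (d i / d j) = nrm x ^ (j - i)"
        using eq by (simp add: nrm_divide)
      moreover have "d i / d j \<in> padic_numbers nrm" "d i / d j \<noteq> 0"
        using d ij is_subfield_divide[OF subfield_padic] by auto
      ultimately obtain k :: int where k: "nrm x ^ (j - i) = real p powi k"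
        using nrm_padic_numbers by metis
      have "j - i dvd fact (card B)"
        using ij by (intro dvd_fact) auto
      then obtain n where "fact (card B) = (j - i) * n" ..
      then have "nrm x ^ fact (card B) = real p powi (k * int n)"
        using k by (simp add: power_mult power_int_mult)
      then show ?thesis ..
    qed
    have "d j \<noteq> 0" using ij nrm_pos[OF x(2)] nrm_pos[of "d i"] by auto
    then show ?thesis
      using *[of i j] *[of j i] ij by (cases "i < j") auto
  qed
  then show ?thesis by (intro exI[of _ "fact (card B)"]) auto
qed

text \<open>Dividing an element of the maximal ideal by one of greatest absolute value leaves an
  integer. This turns the existence of a generator of the ideal into a maximum problem.\<close>

lemma uniformizer_iff_greatest:
  "uniformizer nrm K \<pi> \<longleftrightarrow>
     \<pi> \<in> K \<and> \<pi> \<noteq> 0 \<and> nrm \<pi> < 1 \<and> (\<forall>x\<in>K. nrm x < 1 \<longrightarrow> nrm x \<le> nrm \<pi>)"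
proof
  assume u: "uniformizer nrm K \<pi>"
  then have eq: "max_ideal nrm K = {\<pi> * x |x. x \<in> integers nrm K}" and "\<pi> \<noteq> 0"
    by (auto simp: uniformizer_def)
  have "\<pi> * 1 \<in> max_ideal nrm K"
    unfolding eq using subfield_K by (auto simp: integers_def is_subfield_1 simp del: mult_1_right)
  moreover have "nrm x \<le> nrm \<pi>" if "x \<in> max_ideal nrm K" for x
    using that nrm_nonneg[of \<pi>] unfolding eq
    by (auto simp: integers_def nrm_mult mult_left_le)
  ultimately show "\<pi> \<in> K \<and> \<pi> \<noteq> 0 \<and> nrm \<pi> < 1 \<and> (\<forall>x\<in>K. nrm x < 1 \<longrightarrow> nrm x \<le> nrm \<pi>)"
    using \<open>\<pi> \<noteq> 0\<close> by (auto simp: max_ideal_def)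
next
  assume R: "\<pi> \<in> K \<and> \<pi> \<noteq> 0 \<and> nrm \<pi> < 1 \<and> (\<forall>x\<in>K. nrm x < 1 \<longrightarrow> nrm x \<le> nrm \<pi>)"
  have "x \<in> {\<pi> * x |x. x \<in> integers nrm K}" if "x \<in> max_ideal nrm K" for x
  proof -
    have "x = \<pi> * (x / \<pi>)" using R by simp
    moreover have "x / \<pi> \<in> integers nrm K"
      using R that nrm_pos[of \<pi>] is_subfield_divide[OF subfield_K]
      by (auto simp: integers_def max_ideal_def nrm_divide)
    ultimately show ?thesis by blast
  qed
  moreover have "\<pi> * x \<in> max_ideal nrm K" if "x \<in> integers nrm K" for x
  proof -
    have "nrm \<pi> * nrm x \<le> nrm \<pi>"
      using that nrm_nonneg[of \<pi>] by (simp add: integers_def mult_left_le)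
    then show ?thesis
      using R that is_subfield_mult[OF subfield_K]
      by (auto simp: integers_def max_ideal_def nrm_mult)
  qed
  ultimately show "uniformizer nrm K \<pi>"
    using R by (auto simp: uniformizer_def)
qed

lemma nrm_uniformizer_unique:
  "uniformizer nrm K \<pi> \<Longrightarrow> uniformizer nrm K \<pi>' \<Longrightarrow> nrm \<pi> = nrm \<pi>'"
  by (auto simp: uniformizer_iff_greatest intro: order_antisym)

lemma uniformizer_exists: "\<exists>\<pi>. uniformizer nrm K \<pi>"
proof -
  have p: "real p > 1" using prime_gt_1_nat[OF prime_p] by simp
  obtain m k where m: "m > 0" and k: "\<And>x. x \<in> K \<Longrightarrow> x \<noteq> 0 \<Longrightarrow> nrm x ^ m = real p powi k x"
    using value_group_discrete by (metis Diff_iff singletonD)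
  define S where "S = {x \<in> K. x \<noteq> 0 \<and> nrm x < 1}"
  have neg: "k x < 0" if "x \<in> S" for x
  proof -
    have "nrm x ^ m < 1"
      using that m nrm_nonneg[of x] by (auto simp: S_def power_less_one_iff)
    then have "\<not> real p powi 0 \<le> real p powi k x"
      using that k by (auto simp: S_def)
    then show ?thesis using power_int_increasing[of 0 "k x" "real p"] p by force
  qed
  \<comment> \<open>The set \<open>S\<close> is inhabited and the exponents \<open>k x\<close> are
    negative on it, so well-ordering of the naturals gives an element with the largest
    exponent.\<close>
  have "of_nat p \<in> S"
    using p is_subfield_of_nat[OF subfield_K] by (auto simp: S_def nrm_of_nat_self)
  then obtain \<pi> where \<pi>: "\<pi> \<in> S" "\<And>x. x \<in> S \<Longrightarrow> nat (- k \<pi>) \<le> nat (- k x)"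
    using exists_least_iff[of "\<lambda>n. \<exists>x\<in>S. n = nat (- k x)"] by (metis not_le)
  have "nrm x \<le> nrm \<pi>" if "x \<in> S" for x
  proof -
    have "k x \<le> k \<pi>" using \<pi>(2)[OF that] neg[OF that] neg[OF \<pi>(1)] by simp
    then have "nrm x ^ m \<le> nrm \<pi> ^ m"
      using that \<pi> k p by (auto simp: S_def intro!: power_int_increasing)
    then show ?thesis using m nrm_nonneg by (simp add: power_mono_iff)
  qed
  then have "uniformizer nrm K \<pi>"
    using \<pi>(1) nrm_nonneg[of \<pi>] unfolding uniformizer_iff_greatest S_def by auto (metis nrm_0)
  then show ?thesis ..
qed

text \<open>Scaling \<open>x\<close> by a power of \<pi> moves its absolute value into the interval
  from |\<pi>| (excluded) to 1 (included). No element of \<open>K\<close> has a value strictly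
  between these bounds, so the scaled value is 1.\<close>

lemma nrm_eq_uniformizer_power:
  assumes \<pi>: "uniformizer nrm K \<pi>" and x: "x \<in> K" "x \<noteq> 0"
  shows "\<exists>n::int. nrm x = nrm \<pi> powi n"
proof -
  define r where "r = nrm \<pi>"
  have r: "0 < r" "r < 1" and \<pi>K: "\<pi> \<in> K" and \<pi>0: "\<pi> \<noteq> 0"
    and max: "\<And>y. y \<in> K \<Longrightarrow> nrm y < 1 \<Longrightarrow> nrm y \<le> r"
    using \<pi> nrm_pos by (auto simp: uniformizer_iff_greatest r_def)
  \<comment> \<open>The base \<open>r\<close> is below 1, so rounding the logarithm down gives the
    upper bound \<open>r powi n\<close> for |x|, and the next power lies strictly below |x|.\<close>
  define n where "n = \<lfloor>log r (nrm x)\<rfloor>"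
  have "nrm x = r powr log r (nrm x)" using r nrm_pos[OF x(2)] by simp
  moreover have "r powr log r (nrm x) \<le> r powr n"
    using r by (intro powr_mono') (auto simp: n_def)
  moreover have "r powr (n + 1) < r powr log r (nrm x)"
    using r by (intro powr_less_mono') (auto simp: n_def floor_less_iff)
  ultimately have le: "nrm x \<le> r powi n" and less: "r powi (n + 1) < nrm x"
    using r by (auto simp flip: powr_real_of_int')
  have "\<not> nrm (x / \<pi> powi n) \<le> r"
    using less r by (simp add: nrm_divide nrm_power_int power_int_add field_simps flip: r_def)
  then have "\<not> nrm (x / \<pi> powi n) < 1"
    using max is_subfield_divide[OF subfield_K] is_subfield_power_int[OF subfield_K] x \<pi>K by blast
  then have "r powi n \<le> nrm x"
    using r by (simp add: nrm_divide nrm_power_int field_simps flip: r_def)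
  with le show ?thesis unfolding r_def by (intro exI[of _ n]) simp
qed

lemma unit_integers_iff: "u \<in> unit_integers nrm K \<longleftrightarrow> u \<in> K \<and> nrm u = 1"
proof
  assume "u \<in> unit_integers nrm K"
  then obtain w where w: "u \<in> K" "nrm u \<le> 1" "nrm w \<le> 1" "u * w = 1"
    by (auto simp: unit_integers_def integers_def)
  then have "nrm u * nrm w = 1" by (metis nrm_mult nrm_1)
  then have "1 \<le> nrm u"
    using w(3) nrm_nonneg[of u] mult_left_le[of "nrm w" "nrm u"] by simp
  then show "u \<in> K \<and> nrm u = 1" using w by simp
next
  assume u: "u \<in> K \<and> nrm u = 1"
  then have "u * inverse u = 1" by (intro right_inverse) auto
  then show "u \<in> unit_integers nrm K"
    using u is_subfield_inverse[OF subfield_K, of u]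
    by (auto simp: unit_integers_def integers_def nrm_inverse)
qed

text \<open>The valuation and the ramification index are defined by a description that also
  quantifies over the uniformizer and the unit. For one fixed uniformizer it becomes an equation of
  absolute values, whose exponent is unique by strict monotonicity.\<close>

lemma factorization_iff_nrm:
  assumes "uniformizer nrm K \<pi>" and "x \<in> K"
  shows "(\<exists>\<pi> u. uniformizer nrm K \<pi> \<and> u \<in> unit_integers nrm K \<and> x = u * \<pi> powi n) \<longleftrightarrow>
         nrm x = nrm \<pi> powi n"
proof
  assume "\<exists>\<pi> u. uniformizer nrm K \<pi> \<and> u \<in> unit_integers nrm K \<and> x = u * \<pi> powi n"
  then show "nrm x = nrm \<pi> powi n"
    using nrm_uniformizer_unique[OF assms(1)]
    by (auto simp: unit_integers_iff nrm_mult nrm_power_int)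
next
  assume eq: "nrm x = nrm \<pi> powi n"
  have \<pi>: "\<pi> \<in> K" "\<pi> \<noteq> 0" using assms by (auto simp: uniformizer_iff_greatest)
  then have "x / \<pi> powi n \<in> unit_integers nrm K"
    using eq assms(2) is_subfield_divide[OF subfield_K] is_subfield_power_int[OF subfield_K]
    by (auto simp: unit_integers_iff nrm_divide nrm_power_int nrm_eq_0)
  then show "\<exists>\<pi> u. uniformizer nrm K \<pi> \<and> u \<in> unit_integers nrm K \<and> x = u * \<pi> powi n"
    using assms(1) \<pi> by (intro exI[of _ \<pi>] exI[of _ "x / \<pi> powi n"]) auto
qed

lemma nrm_uniformizer_power_le_iff:
  assumes "uniformizer nrm K \<pi>"
  shows "nrm \<pi> powi m \<le> nrm \<pi> powi n \<longleftrightarrow> n \<le> m"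
proof -
  have "0 < nrm \<pi>" "nrm \<pi> < 1" using assms nrm_pos by (auto simp: uniformizer_iff_greatest)
  then show ?thesis
    using power_int_decreasing[of n m "nrm \<pi>"] power_int_strict_decreasing[of m n "nrm \<pi>"]
    by (cases "n \<le> m") auto
qed

lemma nrm_uniformizer_power_eq_iff:
  assumes "uniformizer nrm K \<pi>"
  shows "nrm \<pi> powi m = nrm \<pi> powi n \<longleftrightarrow> m = n"
  using nrm_uniformizer_power_le_iff[OF assms] by (metis order_antisym order_refl)

lemma normalized_val_eq:
  assumes "uniformizer nrm K \<pi>" "x \<in> K" "nrm x = nrm \<pi> powi n"
  shows "normalized_val nrm K x = ereal (of_int n)"
proof -
  have "x \<noteq> 0" using assms nrm_pos[of \<pi>] by (auto simp: uniformizer_iff_greatest)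
  moreover have "(THE n. \<exists>\<pi> u. uniformizer nrm K \<pi> \<and> u \<in> unit_integers nrm K \<and>
                              x = u * \<pi> powi n) = n"
    unfolding factorization_iff_nrm[OF assms(1,2)]
    using assms(3) nrm_uniformizer_power_eq_iff[OF assms(1)] by (auto intro!: the_equality)
  ultimately show ?thesis by (simp add: normalized_val_def)
qed

lemma nrm_prime_eq_ramification_index:
  assumes "uniformizer nrm K \<pi>"
  shows "nrm (of_nat p) = nrm \<pi> ^ ramification_index p nrm K"
proof -
  have pK: "(of_nat p :: 'a) \<in> K" by (rule is_subfield_of_nat[OF subfield_K])
  have p: "real p > 1" using prime_gt_1_nat[OF prime_p] by simp
  then obtain n :: int where n: "nrm (of_nat p) = nrm \<pi> powi n"
    using nrm_eq_uniformizer_power[OF assms pK] by auto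
  have "nrm (of_nat p) \<le> 1" using p by (simp add: nrm_of_nat_self)
  then have "nrm \<pi> powi n \<le> nrm \<pi> powi 0" using n by simp
  then have "n \<ge> 0" by (simp only: nrm_uniformizer_power_le_iff[OF assms])
  have *: "(\<exists>\<pi> u. uniformizer nrm K \<pi> \<and> u \<in> unit_integers nrm K \<and> of_nat p = u * \<pi> ^ e)
      \<longleftrightarrow> e = nat n" for e
    using factorization_iff_nrm[OF assms pK, of "int e"] \<open>n \<ge> 0\<close> n
      nrm_uniformizer_power_eq_iff[OF assms, of n "int e"] by auto
  have "ramification_index p nrm K = nat n"
    unfolding ramification_index_def * by simp
  then show ?thesis using n \<open>n \<ge> 0\<close> by (simp add: power_int_def)
qed

text \<open>The origin of the bound 1 - ei: with |x| = |\<pi>|^n and |p| = |\<pi>|^e, the product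
  \<open>x * of_nat p ^ i\<close> has value |\<pi>|^(n + ei), which is below 1 exactly when the
  integer n + ei is at least 1.\<close>

lemma normalized_val_ge_iff:
  assumes "x \<in> K"
  shows "normalized_val nrm K x \<ge> ereal (1 - real (ramification_index p nrm K) * real i) \<longleftrightarrow>
         nrm (x * of_nat p ^ i) < 1"
proof (cases "x = 0")
  case True
  then show ?thesis by (simp add: normalized_val_def)
next
  case False
  obtain \<pi> where \<pi>: "uniformizer nrm K \<pi>" using uniformizer_exists ..
  obtain n :: int where n: "nrm x = nrm \<pi> powi n"
    using nrm_eq_uniformizer_power[OF \<pi> assms False] ..
  define e where "e = ramification_index p nrm K"
  have \<pi>0: "nrm \<pi> \<noteq> 0" using \<pi> nrm_eq_0 by (auto simp: uniformizer_iff_greatest)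
  have eq: "nrm (x * of_nat p ^ i) = nrm \<pi> powi (n + int (e * i))"
    using n nrm_prime_eq_ramification_index[OF \<pi>] \<pi>0
    by (simp add: nrm_mult nrm_power power_int_add power_mult flip: e_def of_nat_mult)
  have "nrm (x * of_nat p ^ i) < 1 \<longleftrightarrow> \<not> nrm \<pi> powi 0 \<le> nrm \<pi> powi (n + int (e * i))"
    unfolding eq by (simp add: not_le)
  also have "\<dots> \<longleftrightarrow> n + int (e * i) \<ge> 1"
    unfolding nrm_uniformizer_power_le_iff[OF \<pi>] by auto
  also have "\<dots> \<longleftrightarrow> real_of_int (n + int (e * i)) \<ge> 1"
    by linarith
  also have "\<dots> \<longleftrightarrow> normalized_val nrm K x \<ge> ereal (1 - real e * real i)"
    using normalized_val_eq[OF \<pi> assms n] by auto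
  finally show ?thesis unfolding e_def by simp
qed

end

section \<open>The Weil group\<close>

lemma integers_UNIV_iff [simp]: "x \<in> integers nrm UNIV \<longleftrightarrow> nrm x \<le> 1"
  by (simp add: integers_def)

lemma max_ideal_UNIV_iff [simp]: "x \<in> max_ideal nrm UNIV \<longleftrightarrow> nrm x < 1"
  by (simp add: max_ideal_def)

lemma weil_group_simps [simp]:
  "carrier (weil_group nrm F) = weil_set nrm F" "x \<otimes>\<^bsub>weil_group nrm F\<^esub> y = x \<circ> y"
  "\<one>\<^bsub>weil_group nrm F\<^esub> = id"
  by (simp_all add: weil_group_def)

lemma weil_group_nat_pow: "\<Phi> [^]\<^bsub>weil_group nrm F\<^esub> (n::nat) = \<Phi> ^^ n"
  by (induction n) (auto simp: funpow_swap1 fun_eq_iff)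

lemma galois_id: "id \<in> galois F"
  by (simp add: galois_def)

lemma galois_comp: "\<sigma> \<in> galois F \<Longrightarrow> \<tau> \<in> galois F \<Longrightarrow> \<sigma> \<circ> \<tau> \<in> galois F"
  by (simp add: galois_def bij_comp)

lemma galois_funpow: "\<sigma> \<in> galois F \<Longrightarrow> \<sigma> ^^ n \<in> galois F"
  by (induction n) (simp_all add: galois_id galois_comp del: id_apply)

lemma galois_inv:
  assumes "\<sigma> \<in> galois F"
  shows "inv_into UNIV \<sigma> \<in> galois F"
proof -
  have bij: "bij \<sigma>" and hom: "\<And>x y. \<sigma> (x + y) = \<sigma> x + \<sigma> y" "\<And>x y. \<sigma> (x * y) = \<sigma> x * \<sigma> y"
    and fix_F: "\<And>x. x \<in> F \<Longrightarrow> \<sigma> x = x"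
    using assms by (auto simp: galois_def)
  have eqI: "inv_into UNIV \<sigma> x = y" if "x = \<sigma> y" for x y
    using that bij by (simp add: bij_is_inj)
  have "inv_into UNIV \<sigma> (x + y) = inv_into UNIV \<sigma> x + inv_into UNIV \<sigma> y" "inv_into UNIV \<sigma> (x * y) = inv_into UNIV \<sigma> x * inv_into UNIV \<sigma> y" for x y
    using bij by (auto intro!: eqI simp: hom bij_is_surj surj_f_inv_f)
  then show ?thesis
    using bij fix_F by (auto simp: galois_def bij_imp_bij_inv intro!: eqI)
qed

lemma galois_diff:
  assumes "\<sigma> \<in> galois F"
  shows "\<sigma> (x - y) = \<sigma> x - \<sigma> y"
proof -
  have "\<sigma> ((x - y) + y) = \<sigma> (x - y) + \<sigma> y" using assms unfolding galois_def by blast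
  then show ?thesis by simp
qed

lemma galois_inverse:
  assumes "\<sigma> \<in> galois F"
  shows "\<sigma> (inverse x) = inverse (\<sigma> x)"
proof -
  have bij: "bij \<sigma>" and hom: "\<And>x y. \<sigma> (x + y) = \<sigma> x + \<sigma> y" "\<And>x y. \<sigma> (x * y) = \<sigma> x * \<sigma> y"
    using assms by (auto simp: galois_def)
  have 0: "\<sigma> 0 = 0" using galois_diff[OF assms, of 0 0] by simp
  have "\<sigma> 1 \<noteq> 0" using injD[OF bij_is_inj[OF bij], of 1 0] 0 by auto
  then have 1: "\<sigma> 1 = 1" using hom(2)[of 1 1] by simp
  show ?thesis
  proof (cases "x = 0")
    case False
    then have "\<sigma> x * \<sigma> (inverse x) = 1" by (simp add: 1 flip: hom(2))
    then show ?thesis by (simp add: inverse_unique)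
  qed (simp add: 0)
qed

lemma inertia_subset_weil_set: "inertia nrm F \<subseteq> weil_set nrm F"
  by (auto simp: inertia_def weil_set_def) (rule exI[of _ 0]; simp)

section \<open>Weil group elements on the integers, and their factorization into Frobenius power and
  inertia\<close>

context padic_closure
begin

lemma residue_order_neq_1:
  assumes "0 \<in> F" "1 \<in> F"
  shows "residue_order nrm F \<noteq> 1"
proof
  let ?R = "{(x, y). x \<in> integers nrm F \<and> y \<in> integers nrm F \<and> x - y \<in> max_ideal nrm F}"
  assume "residue_order nrm F = 1"
  then obtain C where C: "integers nrm F // ?R = {C}"
    by (auto simp: residue_order_def card_1_singleton_iff)
  have "?R `` {0} = ?R `` {1}"
    using C assms quotientI[of 0 "integers nrm F" ?R] quotientI[of 1 "integers nrm F" ?R]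
    by (auto simp: integers_def)
  moreover have "1 \<in> ?R `` {1}" using assms by (auto simp: integers_def max_ideal_def)
  ultimately have "(0, 1) \<in> ?R" by blast
  then show False by (simp add: max_ideal_def)
qed

text \<open>Modulo the maximal ideal either \<sigma> x is a power of x or x is a power of \<sigma>
  x. Since the exponent is positive, smallness of x passes to \<sigma> x in both cases.\<close>

lemma weil_set_nrm_less:
  assumes "\<sigma> \<in> weil_set nrm F" "0 < residue_order nrm F" "nrm x < 1"
  shows "nrm (\<sigma> x) < 1"
proof -
  define m where "m n = residue_order nrm F ^ n" for n
  have m: "m n > 0" for n using assms(2) by (simp add: m_def)
  consider n where "residually_equal nrm \<sigma> (\<lambda>x. x ^ m n)"
    | n where "residually_equal nrm (\<lambda>x. \<sigma> x ^ m n) (\<lambda>x. x)"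
    using assms(1) by (auto simp: weil_set_def m_def)
  then show ?thesis
  proof cases
    case 1
    then have "nrm (\<sigma> x - x ^ m n) < 1" using assms(3) by (simp add: residually_equal_def)
    moreover have "nrm (x ^ m n) < 1"
      using assms(3) m[of n] nrm_nonneg[of x] by (simp add: nrm_power power_less_one_iff)
    ultimately show ?thesis using nrm_add_less[of "\<sigma> x - x ^ m n" 1 "x ^ m n"] by simp
  next
    case 2
    then have "nrm (\<sigma> x ^ m n - x) < 1" using assms(3) by (simp add: residually_equal_def)
    then have "nrm (\<sigma> x ^ m n) < 1"
      using assms(3) nrm_add_less[of "\<sigma> x ^ m n - x" 1 x] by simp
    then show ?thesis
      using m[of n] nrm_nonneg[of "\<sigma> x"] by (simp add: nrm_power power_less_one_iff)
  qed
qed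


lemma weil_set_nrm_le:
  assumes "\<sigma> \<in> weil_set nrm F" "0 < residue_order nrm F" "nrm x \<le> 1"
  shows "nrm (\<sigma> x) \<le> 1"
proof -
  define m where "m n = residue_order nrm F ^ n" for n
  have m: "m n > 0" for n using assms(2) by (simp add: m_def)
  consider n where "residually_equal nrm \<sigma> (\<lambda>x. x ^ m n)"
    | n where "residually_equal nrm (\<lambda>x. \<sigma> x ^ m n) (\<lambda>x. x)"
    using assms(1) by (auto simp: weil_set_def m_def)
  then show ?thesis
  proof cases
    case 1
    then have "nrm (\<sigma> x - x ^ m n) < 1" using assms(3) by (simp add: residually_equal_def)
    moreover have "nrm (x ^ m n) \<le> 1"
      using assms(3) nrm_nonneg[of x] by (simp add: nrm_power power_le_one)
    ultimately show ?thesis using nrm_add[of "\<sigma> x - x ^ m n" "x ^ m n"] by simp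
  next
    case 2
    then have "nrm (\<sigma> x ^ m n - x) < 1" using assms(3) by (simp add: residually_equal_def)
    then have "nrm (\<sigma> x ^ m n) \<le> 1"
      using assms(3) nrm_add[of "\<sigma> x ^ m n - x" x] by simp
    then show ?thesis
      using m[of n] nrm_nonneg[of "\<sigma> x"] by (simp add: nrm_power power_le_one_iff)
  qed
qed

text \<open>If |x| > 1, then the inverse of x lies in the open unit ball, which \<sigma> preserves;
  hence |\<sigma> x| > 1.\<close>

lemma weil_set_nrm_le_iff:
  assumes "\<sigma> \<in> weil_set nrm F" "0 < residue_order nrm F"
  shows "nrm (\<sigma> x) \<le> 1 \<longleftrightarrow> nrm x \<le> 1"
proof
  assume le: "nrm (\<sigma> x) \<le> 1"
  show "nrm x \<le> 1"
  proof (rule ccontr)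
    assume gt: "\<not> nrm x \<le> 1"
    then have "nrm (inverse x) < 1" by (simp add: nrm_inverse inverse_less_1_iff)
    then have "nrm (\<sigma> (inverse x)) < 1" by (rule weil_set_nrm_less[OF assms])
    moreover have "\<sigma> (inverse x) = inverse (\<sigma> x)"
      using assms(1) by (intro galois_inverse[of _ F]) (simp add: weil_set_def)
    moreover have "\<sigma> x \<noteq> 0"
    proof
      assume "\<sigma> x = 0"
      moreover have "\<sigma> 0 = 0" and "inj \<sigma>"
        using assms(1) galois_diff[of \<sigma> F 0 0]
        by (auto simp: weil_set_def galois_def bij_is_inj)
      ultimately have "x = 0" by (metis injD)
      then show False using gt by simp
    qed
    ultimately show False
      using le nrm_pos[of "\<sigma> x"] by (auto simp: nrm_inverse inverse_less_1_iff)
  qed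
qed (rule weil_set_nrm_le[OF assms])

text \<open>Inversion exchanges the two alternatives in \<open>weil_set\<close>, by substituting the
  preimage of x for x; the preimage is integral by \<open>weil_set_nrm_le_iff\<close>.\<close>

lemma inv_weil_set:
  assumes "\<sigma> \<in> weil_set nrm F" "0 < residue_order nrm F"
  shows "inv_into UNIV \<sigma> \<in> weil_set nrm F"
proof -
  have G: "\<sigma> \<in> galois F" using assms(1) by (simp add: weil_set_def)
  then have bij: "bij \<sigma>" by (simp add: galois_def)
  have surj: "\<sigma> (inv_into UNIV \<sigma> x) = x" for x using bij by (simp add: bij_is_surj surj_f_inv_f)
  have le: "nrm (inv_into UNIV \<sigma> x) \<le> 1" if "nrm x \<le> 1" for x
    using that weil_set_nrm_le_iff[OF assms, of "inv_into UNIV \<sigma> x"] by (simp add: surj)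
  have 1: "residually_equal nrm (\<lambda>x. inv_into UNIV \<sigma> x ^ k) (\<lambda>x. x)"
    if R: "residually_equal nrm \<sigma> (\<lambda>x. x ^ k)" for k
  proof -
    have "nrm (inv_into UNIV \<sigma> x ^ k - x) < 1" if "nrm x \<le> 1" for x
      using R[unfolded residually_equal_def, rule_format, of "inv_into UNIV \<sigma> x"] le[OF that]
      by (simp add: surj nrm_minus_commute[of x])
    then show ?thesis by (simp add: residually_equal_def)
  qed
  have 2: "residually_equal nrm (inv_into UNIV \<sigma>) (\<lambda>x. x ^ k)"
    if R: "residually_equal nrm (\<lambda>x. \<sigma> x ^ k) (\<lambda>x. x)" for k
  proof -
    have "nrm (inv_into UNIV \<sigma> x - x ^ k) < 1" if "nrm x \<le> 1" for x
      using R[unfolded residually_equal_def, rule_format, of "inv_into UNIV \<sigma> x"] le[OF that]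
      by (simp add: surj nrm_minus_commute[of _ "x ^ k"])
    then show ?thesis by (simp add: residually_equal_def)
  qed
  obtain n where "residually_equal nrm \<sigma> (\<lambda>x. x ^ (residue_order nrm F ^ n)) \<or>
      residually_equal nrm (\<lambda>x. \<sigma> x ^ (residue_order nrm F ^ n)) (\<lambda>x. x)"
    using assms(1) by (auto simp: weil_set_def)
  then have "residually_equal nrm (inv_into UNIV \<sigma>) (\<lambda>x. x ^ (residue_order nrm F ^ n)) \<or>
      residually_equal nrm (\<lambda>x. inv_into UNIV \<sigma> x ^ (residue_order nrm F ^ n)) (\<lambda>x. x)"
    using 1 2 by (elim disjE) simp_all
  then show ?thesis using galois_inv[OF G] by (auto simp: weil_set_def)
qed

text \<open>Negative powers of \<Phi> are formed with the group inverse, which this identifies with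
  the inverse map.\<close>

lemma weil_group_m_inv:
  assumes "\<sigma> \<in> weil_set nrm F" "0 < residue_order nrm F"
  shows "inv\<^bsub>weil_group nrm F\<^esub> \<sigma> = inv_into UNIV \<sigma>"
proof -
  have "bij \<sigma>" using assms(1) by (simp add: weil_set_def galois_def)
  then have "\<sigma> \<circ> inv_into UNIV \<sigma> = id" "inv_into UNIV \<sigma> \<circ> \<sigma> = id"
    using bij_is_surj bij_is_inj surj_iff inj_iff by metis+
  then show ?thesis
    unfolding m_inv_def weil_group_simps
    using inv_weil_set[OF assms] by (intro the_equality) (auto intro: inv_unique_comp[symmetric])
qed

lemma nrm_power_diff_less:
  assumes "nrm x \<le> 1" "nrm y \<le> 1" "nrm (x - y) < 1"
  shows "nrm (x ^ k - y ^ k) < 1"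
proof (induction k)
  case (Suc k)
  have "x ^ Suc k - y ^ Suc k = x * (x ^ k - y ^ k) + y ^ k * (x - y)"
    by (simp add: algebra_simps)
  moreover have "nrm (x * (x ^ k - y ^ k)) < 1"
    using assms Suc by (intro nrm_mult_less)
  moreover have "nrm (y ^ k * (x - y)) < 1"
    using assms nrm_nonneg[of y] by (intro nrm_mult_less) (auto simp: nrm_power power_le_one)
  ultimately show ?case by (simp add: nrm_add_less)
qed simp

lemma frobenius_weil_set: "frobenius_element nrm F \<Phi> \<Longrightarrow> \<Phi> \<in> weil_set nrm F"
  by (simp add: frobenius_element_def weil_set_def) (rule exI[of _ 1]; simp)

lemma frobenius_funpow:
  assumes "frobenius_element nrm F \<Phi>" "0 < residue_order nrm F"
  shows "residually_equal nrm (\<lambda>x. (\<Phi> ^^ n) x ^ (residue_order nrm F ^ n)) (\<lambda>x. x)"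
    (is "residually_equal nrm (\<lambda>x. _ ^ (?q ^ n)) _")
proof (induction n)
  case 0
  show ?case by (simp add: residually_equal_def)
next
  case (Suc n)
  note W = frobenius_weil_set[OF assms(1)]
  have "nrm ((\<Phi> ^^ Suc n) x ^ (?q ^ Suc n) - x) < 1" if x: "nrm x \<le> 1" for x
  proof -
    have le: "nrm ((\<Phi> ^^ n) x) \<le> 1" for n
      using x weil_set_nrm_le[OF W assms(2)] by (induction n) auto
    have "nrm (\<Phi> ((\<Phi> ^^ n) x) ^ ?q - (\<Phi> ^^ n) x) < 1"
      using le[of n] assms(1) by (simp add: frobenius_element_def residually_equal_def)
    then have "nrm ((\<Phi> ((\<Phi> ^^ n) x) ^ ?q) ^ (?q ^ n) - (\<Phi> ^^ n) x ^ (?q ^ n)) < 1"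
      using le[of n] le[of "Suc n"] nrm_nonneg
      by (intro nrm_power_diff_less) (auto simp: nrm_power power_le_one)
    moreover have "nrm ((\<Phi> ^^ n) x ^ (?q ^ n) - x) < 1"
      using Suc x by (simp add: residually_equal_def)
    ultimately show ?thesis
      using nrm_diff_trans[of "(\<Phi> ((\<Phi> ^^ n) x) ^ ?q) ^ (?q ^ n)" "(\<Phi> ^^ n) x ^ (?q ^ n)"]
      by (simp add: power_mult)
  qed
  then show ?case by (simp add: residually_equal_def)
qed

text \<open>The power \<Psi> of \<Phi> inverts the q^n-th power map on residues. If g induces that
  power map, then \<Psi> g is inertial; if g induces its inverse, then the inverse of \<Psi>
  composed with g is inertial.\<close>

lemma weil_set_decomposition:
  assumes \<Phi>: "frobenius_element nrm F \<Phi>" and q: "0 < residue_order nrm F" (is "0 < ?q")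
    and g: "g \<in> weil_set nrm F"
  obtains k :: int and \<tau> where "\<tau> \<in> inertia nrm F" "g = \<Phi> [^]\<^bsub>weil_group nrm F\<^esub> k \<circ> \<tau>"
proof -
  have \<Phi>G: "\<Phi> \<in> galois F" using \<Phi> by (simp add: frobenius_element_def)
  have gG: "g \<in> galois F" using g by (simp add: weil_set_def)
  obtain n where n: "residually_equal nrm g (\<lambda>x. x ^ (?q ^ n)) \<or>
      residually_equal nrm (\<lambda>x. g x ^ (?q ^ n)) (\<lambda>x. x)"
    using g by (auto simp: weil_set_def)
  define \<Psi> where "\<Psi> = \<Phi> ^^ n"
  have \<Psi>G: "\<Psi> \<in> galois F" unfolding \<Psi>_def by (rule galois_funpow[OF \<Phi>G])
  have \<Psi>: "nrm (\<Psi> x ^ (?q ^ n) - x) < 1" if "nrm x \<le> 1" for x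
    using frobenius_funpow[OF \<Phi> q, of n] that by (simp add: residually_equal_def \<Psi>_def)
  have \<Psi>W: "\<Psi> \<in> weil_set nrm F"
    using \<Psi>G frobenius_funpow[OF \<Phi> q, of n] by (auto simp: weil_set_def \<Psi>_def)
  have inv: "\<Psi> (inv_into UNIV \<Psi> x) = x" "inv_into UNIV \<Psi> (\<Psi> x) = x" for x
    using \<Psi>G by (auto simp: galois_def bij_is_surj bij_is_inj surj_f_inv_f)
  note le = weil_set_nrm_le[OF \<Psi>W q] weil_set_nrm_le[OF inv_weil_set[OF \<Psi>W q] q]
  from n show ?thesis
  proof
    assume n: "residually_equal nrm g (\<lambda>x. x ^ (?q ^ n))"
    have "nrm (\<Psi> (g x) - x) < 1" if x: "nrm x \<le> 1" for x
    proof -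
      \<comment> \<open>Since \<Psi> y = x, the q^n-th power of x is congruent to y, and hence so is
        g x; applying \<Psi> gives the claim.\<close>
      define y where "y = inv_into UNIV \<Psi> x"
      have y: "nrm y \<le> 1" "\<Psi> y = x" using x le by (auto simp: y_def inv)
      have "nrm (g x - x ^ (?q ^ n)) < 1" using n x by (simp add: residually_equal_def)
      then have "nrm (g x - y) < 1"
        using nrm_diff_trans[OF _ \<Psi>[OF y(1)], of "g x"] y by simp
      then have "nrm (\<Psi> (g x - y)) < 1" by (rule weil_set_nrm_less[OF \<Psi>W q])
      then show ?thesis by (simp add: galois_diff[OF \<Psi>G] y)
    qed
    then have I: "\<Psi> \<circ> g \<in> inertia nrm F"
      using galois_comp[OF \<Psi>G gG] by (simp add: inertia_def residually_equal_def)
    have pow: "\<Phi> [^]\<^bsub>weil_group nrm F\<^esub> (- int n) = inv_into UNIV \<Psi>"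
      using weil_group_m_inv[OF \<Psi>W q] by (auto simp: int_pow_def2 weil_group_nat_pow \<Psi>_def)
    have "g = inv_into UNIV \<Psi> \<circ> (\<Psi> \<circ> g)" by (simp add: inv fun_eq_iff)
    then show ?thesis by (intro that[OF I, of "- int n"]) (simp only: pow)
  next
    assume n: "residually_equal nrm (\<lambda>x. g x ^ (?q ^ n)) (\<lambda>x. x)"
    have "nrm (inv_into UNIV \<Psi> (g x) - x) < 1" if x: "nrm x \<le> 1" for x
    proof -
      \<comment> \<open>Here \<Psi> y = g x, so the q^n-th power of g x is congruent both to y and
        to x.\<close>
      define y where "y = inv_into UNIV \<Psi> (g x)"
      have y: "nrm y \<le> 1" "\<Psi> y = g x"
        using x le weil_set_nrm_le[OF g q] by (auto simp: y_def inv)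
      have "nrm (g x ^ (?q ^ n) - x) < 1" using n x by (simp add: residually_equal_def)
      then show ?thesis
        using nrm_diff_trans[of y "g x ^ (?q ^ n)"] \<Psi>[OF y(1)] y
        by (simp add: nrm_minus_commute[of y "g x ^ (?q ^ n)"] flip: y_def)
    qed
    then have I: "inv_into UNIV \<Psi> \<circ> g \<in> inertia nrm F"
      using galois_comp[OF galois_inv[OF \<Psi>G] gG] by (simp add: inertia_def residually_equal_def)
    have pow: "\<Phi> [^]\<^bsub>weil_group nrm F\<^esub> (int n) = \<Psi>"
      by (simp add: int_pow_int weil_group_nat_pow \<Psi>_def)
    have "g = \<Psi> \<circ> (inv_into UNIV \<Psi> \<circ> g)" by (simp add: inv fun_eq_iff)
    then show ?thesis by (intro that[OF I, of "int n"]) (simp only: pow)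
  qed
qed

end

section \<open>Triangular representations of degree two\<close>

lemma mat2_simps [simp]:
  "mat2 a b c d $ 1 $ 1 = a" "mat2 a b c d $ 1 $ 2 = b"
  "mat2 a b c d $ 2 $ 1 = c" "mat2 a b c d $ 2 $ 2 = d"
  by (simp_all add: mat2_def)

lemma matrix_mult_2:
  fixes A B :: "'k::field ^ 2 ^ 2"
  shows "(A ** B) $ i $ j = A $ i $ 1 * B $ 1 $ j + A $ i $ 2 * B $ 2 $ j"
  by (simp add: matrix_matrix_mult_def sum_2)

lemma mat2_mult:
  "mat2 a b c d ** mat2 a' b' c' d' =
     mat2 (a * a' + b * c') (a * b' + b * d') (c * a' + d * c') (c * b' + d * (d' :: 'k::field))"
  by (simp add: vec_eq_iff forall_2 matrix_mult_2)

lemma mat2_mult_vec: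
  fixes w :: "'k::field ^ 2"
  shows "(mat2 a b c d *v w) $ 1 = a * w $ 1 + b * w $ 2"
    "(mat2 a b c d *v w) $ 2 = c * w $ 1 + d * w $ 2"
  by (simp_all add: matrix_vector_mult_def sum_2)

lemma mat_1_eq_mat2: "mat 1 = mat2 1 0 0 (1 :: 'k::field)"
  by (simp add: mat_def vec_eq_iff forall_2)

text \<open>The inverse \<open>B\<close> is not assumed triangular. Because of the zero corner, the
  upper left entry of one product and the lower right entry of the other each involve a single
  diagonal entry.\<close>

lemma GL_over_triangular_unit:
  assumes "mat2 x y 0 z \<in> GL_over R"
  shows "\<exists>w\<in>R. x * w = 1" "\<exists>w\<in>R. z * w = 1"
proof -
  obtain B where B: "\<And>i j. B $ i $ j \<in> R" "mat2 x y 0 z ** B = mat 1" "B ** mat2 x y 0 z = mat 1"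
    using assms by (auto simp: GL_over_def)
  have "(B ** mat2 x y 0 z) $ 1 $ 1 = 1" "(mat2 x y 0 z ** B) $ 2 $ 2 = 1"
    by (simp_all add: B mat_def)
  then have "B $ 1 $ 1 * x = 1" "z * B $ 2 $ 2 = 1" by (simp_all add: matrix_mult_2)
  then show "\<exists>w\<in>R. x * w = 1" "\<exists>w\<in>R. z * w = 1"
    using B(1) by (metis mult.commute)+
qed

lemma subspace_axis_1: "vec.subspace {w :: 'k::field ^ 2. w $ 2 = 0}"
  and subspace_axis_2: "vec.subspace {w :: 'k::field ^ 2. w $ 1 = 0}"
  by (auto simp: vec.subspace_def)

lemma reducible_triangular:
  assumes "\<And>g. g \<in> G \<Longrightarrow> r g = mat2 (x g) (y g) 0 (z g)"
  shows "reducible_rep G (r :: 'g \<Rightarrow> 'k::field ^ 2 ^ 2)"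
  unfolding reducible_rep_def
proof (intro exI conjI)
  show "invariant_subspace G r {w. w $ 2 = 0}"
    using assms by (auto simp: invariant_subspace_def subspace_axis_1 mat2_mult_vec)
  have "vector [1, 0] \<in> {w :: 'k ^ 2. w $ 2 = 0}" "vector [1, 0] \<noteq> (0 :: 'k ^ 2)"
    by (simp_all add: vec_eq_iff forall_2)
  then show "{w :: 'k ^ 2. w $ 2 = 0} \<noteq> {0}" by blast
  have "vector [0, 1] \<notin> {w :: 'k ^ 2. w $ 2 = 0}" by simp
  then show "{w :: 'k ^ 2. w $ 2 = 0} \<noteq> UNIV" by blast
qed

lemma decomposable_char_sum:
  assumes "\<And>g. g \<in> G \<Longrightarrow> r g = mat2 (x g) 0 0 (z g)"
  shows "decomposable_rep G (r :: 'g \<Rightarrow> 'k::field ^ 2 ^ 2)"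
  unfolding decomposable_rep_def
proof (intro exI conjI)
  show "invariant_subspace G r {w. w $ 2 = 0}" "invariant_subspace G r {w. w $ 1 = 0}"
    using assms by (auto simp: invariant_subspace_def subspace_axis_1 subspace_axis_2 mat2_mult_vec)
  have "vector [1, 0] \<in> {w :: 'k ^ 2. w $ 2 = 0}" "vector [1, 0] \<noteq> (0 :: 'k ^ 2)"
    by (simp_all add: vec_eq_iff forall_2)
  then show "{w :: 'k ^ 2. w $ 2 = 0} \<noteq> {0}" by blast
  have "vector [0, 1] \<in> {w :: 'k ^ 2. w $ 1 = 0}" "vector [0, 1] \<noteq> (0 :: 'k ^ 2)"
    by (simp_all add: vec_eq_iff forall_2)
  then show "{w :: 'k ^ 2. w $ 1 = 0} \<noteq> {0}" by blast
  have int: "{w :: 'k ^ 2. w $ 2 = 0} \<inter> {w. w $ 1 = 0} = {0}"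
    by (auto simp: vec_eq_iff forall_2)
  have all: "w \<in> {u + w |u w. u \<in> {w :: 'k ^ 2. w $ 2 = 0} \<and> w \<in> {w. w $ 1 = 0}}" for w
  proof -
    have "w = vector [w $ 1, 0] + vector [0, w $ 2]" by (simp add: vec_eq_iff forall_2)
    moreover have "vector [w $ 1, 0] \<in> {w :: 'k ^ 2. w $ 2 = 0}"
      "vector [0, w $ 2] \<in> {w :: 'k ^ 2. w $ 1 = 0}" by simp_all
    ultimately show ?thesis by blast
  qed
  show "complementary {w :: 'k ^ 2. w $ 2 = 0} {w. w $ 1 = 0}"
    unfolding complementary_def by (intro conjI int UNIV_eq_I[symmetric] all)
qed

text \<open>Every nonzero subspace stable under a non-diagonal \<open>mat2 z y 0 z\<close> contains the first
  basis vector.\<close>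

lemma not_decomposable_unipotent:
  assumes "g \<in> G" "r g = mat2 z y 0 z" "y \<noteq> 0"
  shows "\<not> decomposable_rep G (r :: 'g \<Rightarrow> 'k::field ^ 2 ^ 2)"
proof
  have e1: "vector [1, 0] \<in> U" if U: "invariant_subspace G r U" "U \<noteq> {0}" for U
  proof -
    have sub: "vec.subspace U" and stable: "\<And>w. w \<in> U \<Longrightarrow> mat2 z y 0 z *v w \<in> U"
      using U(1) assms(1,2) by (auto simp: invariant_subspace_def)
    have "0 \<in> U" using sub by (rule vec.subspace_0)
    then obtain u where u: "u \<in> U" "u \<noteq> 0" using U(2) by blast
    show ?thesis
    proof (cases "u $ 2 = 0")
      case True
      then have "u $ 1 \<noteq> 0" using u(2) by (simp add: vec_eq_iff forall_2)
      then have eq: "vector [1, 0] = inverse (u $ 1) *s u"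
        using True by (simp add: vec_eq_iff forall_2)
      show ?thesis unfolding eq by (rule vec.subspace_scale[OF sub u(1)])
    next
      case False
      then have eq: "vector [1, 0] = inverse (y * u $ 2) *s (mat2 z y 0 z *v u - z *s u)"
        using assms(3) by (simp add: vec_eq_iff forall_2 mat2_mult_vec field_simps)
      show ?thesis
        unfolding eq by (intro vec.subspace_scale vec.subspace_diff sub stable u(1))
    qed
  qed
  assume "decomposable_rep G r"
  then obtain U W where "invariant_subspace G r U" "U \<noteq> {0}" "invariant_subspace G r W" "W \<noteq> {0}"
    and int: "U \<inter> W = {0}"
    by (auto simp: decomposable_rep_def complementary_def)
  then have "vector [1, 0] \<in> U \<inter> W" by (intro IntI e1)
  then have "vector [1, 0] = (0 :: 'k ^ 2)" unfolding int by simp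
  then show False by (simp add: vec_eq_iff forall_2)
qed

text \<open>The corner \<open>c * (z g - x g)\<close> is a coboundary: one unipotent matrix,
  independent of \<open>g\<close>, removes it.\<close>

lemma isomorphic_triangular_char_sum:
  assumes "\<And>g. g \<in> G \<Longrightarrow> r g = mat2 (x g) (c * (z g - x g)) 0 (z g)"
  shows "isomorphic_reps G (r :: 'g \<Rightarrow> 'k::field ^ 2 ^ 2) (char_sum x z)"
  unfolding isomorphic_reps_def
proof (intro exI[of _ "mat2 1 (- c) 0 1"] conjI ballI)
  show "invertible (mat2 1 (- c) 0 1)"
    unfolding invertible_def
    by (intro exI[of _ "mat2 1 c 0 1"]) (simp add: mat2_mult mat_1_eq_mat2)
  show "mat2 1 (- c) 0 1 ** r g = char_sum x z g ** mat2 1 (- c) 0 1" if "g \<in> G" for g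
    using assms[OF that] by (simp add: char_sum_def mat2_mult algebra_simps)
qed

text \<open>A matrix conjugate to a scalar one is scalar. Concretely, \<open>y\<close> annihilates
  the first column of the intertwiner \<open>P\<close>, which is nonzero as \<open>P\<close> is
  invertible.\<close>

lemma isomorphic_char_sum_scalar:
  assumes "isomorphic_reps G (r :: 'g \<Rightarrow> 'k::field ^ 2 ^ 2) (char_sum x z)"
    and "g \<in> G" "r g = mat2 (z g) y 0 (z g)" "x g = z g"
  shows "y = 0"
proof -
  obtain P where P: "invertible P" "P ** mat2 (z g) y 0 (z g) = mat2 (z g) 0 0 (z g) ** P"
    using assms by (auto simp: isomorphic_reps_def char_sum_def)
  have "(P ** mat2 (z g) y 0 (z g)) $ i $ 2 = (mat2 (z g) 0 0 (z g) ** P) $ i $ 2" for i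
    using P(2) by simp
  from this[of 1] this[of 2] have "P $ 1 $ 1 * y = 0" "P $ 2 $ 1 * y = 0"
    by (simp_all add: matrix_mult_2 mult.commute)
  moreover obtain Q where "Q ** P = mat 1" using P(1) by (auto simp: invertible_def)
  then have "(Q ** P) $ 1 $ 1 = 1" by (simp add: mat_def)
  then have "Q $ 1 $ 1 * P $ 1 $ 1 + Q $ 1 $ 2 * P $ 2 $ 1 = 1" by (simp add: matrix_mult_2)
  ultimately show "y = 0" by (cases "y = 0") auto
qed

section \<open>The reduction of a special representation\<close>

lemma greatest_cong_prime_power:
  fixes q l :: nat
  assumes "prime l" "q > 1"
  shows "(GREATEST j. [q = 1] (mod l ^ j)) = multiplicity l (q - 1)"
proof -
  have "[q = 1] (mod l ^ j) \<longleftrightarrow> j \<le> multiplicity l (q - 1)" for j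
    using assms prime_gt_1_nat[OF assms(1)]
    by (simp add: cong_altdef_nat power_dvd_iff_le_multiplicity)
  then show ?thesis by (auto intro: Greatest_equality)
qed

section \<open>The absolute values of q - 1 and of 1 - u^k\<close>

context padic_closure
begin

lemma nrm_pred_eq_prime_power:
  assumes "q > 1"
  shows "nrm (of_nat q - 1) = nrm (of_nat p ^ (GREATEST j. [q = 1] (mod p ^ j)))"
proof -
  obtain m where m: "q - 1 = p ^ multiplicity p (q - 1) * m" "\<not> p dvd m"
    using multiplicity_decompose'[of "q - 1" p] assms prime_gt_1_nat[OF prime_p] by auto
  have "of_nat q - 1 = (of_nat (q - 1) :: 'a)" using assms by simp
  also have "nrm \<dots> = nrm (of_nat p ^ multiplicity p (q - 1))"
    using nrm_of_nat_not_dvd[OF m(2)] by (subst m(1)) (simp add: nrm_mult)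
  finally show ?thesis unfolding greatest_cong_prime_power[OF prime_p assms] .
qed

lemma nrm_of_nat_le_1: "nrm (of_nat n) \<le> 1"
proof (induction n)
  case (Suc n)
  then show ?case using nrm_add[of 1 "of_nat n"] by simp
qed simp

lemma nrm_pred_less_1_iff:
  assumes "q > 0"
  shows "nrm (of_nat q - 1) < 1 \<longleftrightarrow> [q = 1] (mod p)"
proof -
  have eq: "of_nat q - 1 = (of_nat (q - 1) :: 'a)" using assms by simp
  have cong: "[q = 1] (mod p) \<longleftrightarrow> p dvd q - 1" using assms by (simp add: cong_altdef_nat)
  show ?thesis
  proof
    assume "[q = 1] (mod p)"
    then obtain m where "q - 1 = m * p" unfolding cong by (metis dvd_def mult.commute)
    moreover have "nrm (of_nat p) < 1"
      using prime_gt_1_nat[OF prime_p] by (simp add: nrm_of_nat_self)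
    ultimately show "nrm (of_nat q - 1) < 1"
      unfolding eq by (simp add: nrm_mult_less nrm_of_nat_le_1)
  next
    assume "nrm (of_nat q - 1) < 1"
    then show "[q = 1] (mod p)"
      unfolding eq cong using nrm_of_nat_not_dvd[of "q - 1"] by force
  qed
qed

text \<open>This is divisibility of 1 - u^k by 1 - u for a unit u; a negative exponent only
  contributes a sign and a unit factor. It bounds 1 - \<omega> at every Weil group element by its
  value at \<Phi>.\<close>

lemma nrm_one_minus_power_int_le:
  assumes "nrm u = 1"
  shows "nrm (1 - u powi k) \<le> nrm (1 - u)"
proof -
  have nat: "nrm (1 - u ^ n) \<le> nrm (1 - u)" for n
  proof (induction n)
    case (Suc n)
    have eq: "1 - u ^ Suc n = (1 - u) + u * (1 - u ^ n)" by (simp add: algebra_simps)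
    show ?case
      unfolding eq using nrm_add[of "1 - u" "u * (1 - u ^ n)"] Suc assms by (simp add: nrm_mult)
  qed (simp add: nrm_nonneg)
  have u: "u \<noteq> 0" using assms by auto
  show ?thesis
  proof (cases "k \<ge> 0")
    case False
    define n where "n = nat (- k)"
    have "1 - u powi k = - (1 - u ^ n) / u ^ n"
      using False u by (simp add: power_int_def n_def field_simps)
    then show ?thesis using nat[of n] assms by (simp add: nrm_divide nrm_power nrm_minus_commute)
  qed (use nat in \<open>auto simp: power_int_def\<close>)
qed

end

section \<open>The reduction map on the integers of \<open>K\<close>\<close>

context local_field
begin

lemma integers_closed:
  assumes "x \<in> integers nrm K" "y \<in> integers nrm K"
  shows "x + y \<in> integers nrm K" "x - y \<in> integers nrm K" "x * y \<in> integers nrm K"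
  using assms nrm_add[of x y] nrm_diff[of x y] mult_le_one[of "nrm x" "nrm y"] nrm_nonneg[of y]
  by (auto simp: integers_def nrm_mult is_subfield_add[OF subfield_K] is_subfield_diff[OF subfield_K]
      is_subfield_mult[OF subfield_K])

lemma red_diff:
  assumes "reduction_map nrm K red" "x \<in> integers nrm K" "y \<in> integers nrm K"
  shows "red (x - y) = red x - red y"
proof -
  have "red ((x - y) + y) = red (x - y) + red y"
    using assms integers_closed(2)[OF assms(2,3)] unfolding reduction_map_def by blast
  then show ?thesis by simp
qed

lemma red_eq_0_iff:
  "reduction_map nrm K red \<Longrightarrow> x \<in> integers nrm K \<Longrightarrow> red x = 0 \<longleftrightarrow> nrm x < 1"
  by (auto simp: reduction_map_def max_ideal_def integers_def)

lemma red_eq_iff: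
  assumes "reduction_map nrm K red" "x \<in> integers nrm K" "y \<in> integers nrm K"
  shows "red x = red y \<longleftrightarrow> nrm (x - y) < 1"
  using red_eq_0_iff[OF assms(1) integers_closed(2)[OF assms(2,3)]] red_diff[OF assms] by auto

end

lemma reduce_rep_mat2:
  "r g = mat2 x y z w \<Longrightarrow> reduce_rep red r g = mat2 (red x) (red y) (red z) (red w)"
  by (simp add: reduce_rep_def vec_eq_iff forall_2)

theorem theorem2p15:
  fixes p l q e i :: nat
    and nrmp :: "'a::{alg_closed_field, field_char_0} \<Rightarrow> real"
    and nrml :: "'b::{alg_closed_field, field_char_0} \<Rightarrow> real"
    and F :: "'a set" and K :: "'b set"
    and \<Phi> :: "'a \<Rightarrow> 'a"
    and \<omega> t chi :: "('a \<Rightarrow> 'a) \<Rightarrow> 'b"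
    and \<rho> \<rho>\<Phi> :: "('a \<Rightarrow> 'a) \<Rightarrow> 'b ^ 2 ^ 2" and N :: "'b ^ 2 ^ 2"
    and a b d :: 'b
    and W :: "('a \<Rightarrow> 'a) set"
    and \<rho>bar sumbar :: "('a \<Rightarrow> 'a) \<Rightarrow> 'k::field ^ 2 ^ 2"
    and red :: "'b \<Rightarrow> 'k"
  assumes "odd p" and "odd l" and "p \<noteq> l"
    and "padic_closure p nrmp" and "padic_closure l nrml"
    and "finite_extension (padic_numbers nrmp) F" and "q = residue_order nrmp F"
    and "finite_extension (padic_numbers nrml) K"
    and "reduction_map nrml K red"
    and "W = weil_set nrmp F"
    and "frobenius_element nrmp F \<Phi>"
    and "weil_character nrmp F nrml \<omega>"
    and "\<And>(k::int) \<tau>. \<tau> \<in> inertia nrmp F \<Longrightarrow>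
           \<omega> (\<Phi> [^]\<^bsub>weil_group nrmp F\<^esub> k \<circ> \<tau>) = of_nat q powi (- k)"
    and "tame_hom nrmp F nrml t"
    and "weil_representation nrmp F nrml \<rho>"
    and "\<rho> ` W \<subseteq> GL_over (integers nrml K)"
    and "associated_weil_deligne nrmp F nrml \<Phi> t \<rho> \<rho>\<Phi> N"
    and "semisimple_rep W \<rho>\<Phi>"
    and "special_weil_deligne nrmp F nrml \<omega> \<rho>\<Phi> N"
    and "weil_character nrmp F nrml chi"
    and "a \<in> K" and "b \<in> K" and "d \<in> K" and "a * d \<noteq> 0"
    and "\<And>(k::int) \<tau> g. \<tau> \<in> inertia nrmp F \<Longrightarrow> g = \<Phi> [^]\<^bsub>weil_group nrmp F\<^esub> k \<circ> \<tau> \<Longrightarrow>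
           \<rho> g = mat2 (chi g * \<omega> g)
                       (a / d * t \<tau> * (chi g * \<omega> g) + b / d * (chi g - chi g * \<omega> g))
                       0 (chi g)"
    and "\<rho>bar = reduce_rep red \<rho>"
    and "sumbar = char_sum (\<lambda>g. red (chi g * \<omega> g)) (\<lambda>g. red (chi g))"
    and "e = ramification_index l nrml K"
    and "i = (GREATEST j. [q = 1] (mod l ^ j))"
  shows "reducible_rep W \<rho>bar \<and>
    (a / d \<in> unit_integers nrml K \<longrightarrow> \<not> decomposable_rep W \<rho>bar) \<and>
    (\<not> [q = 1] (mod l) \<and> a / d \<in> max_ideal nrml K \<longrightarrow>
       isomorphic_reps W \<rho>bar sumbar) \<and>
    ([q = 1] (mod l) \<and> a / d \<in> max_ideal nrml K \<longrightarrow>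
       (decomposable_rep W \<rho>bar \<longleftrightarrow> normalized_val nrml K (b / d) \<ge> ereal (1 - real e * real i)) \<and>
       (isomorphic_reps W \<rho>bar sumbar \<longleftrightarrow>
          normalized_val nrml K (b / d) \<ge> ereal (1 - real e * real i)))"
proof -
  interpret P: padic_closure p nrmp by fact
  interpret L: padic_closure l nrml by fact
  interpret L: local_field l nrml K by unfold_locales fact
  note red = assms(9) and W = assms(10) and frob = assms(11) and \<omega>_pow = assms(13)
    and tame = assms(14) and GL = assms(16) and \<rho>_formula = assms(25)
  note K = is_subfield_divide[OF L.subfield_K] is_subfield_mult[OF L.subfield_K]
  let ?O = "integers nrml K"
  have ad: "a / d \<in> K" and bd: "b / d \<in> K" using assms(21-23) K by auto

  have id_inertia: "id \<in> inertia nrmp F"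
    by (simp add: inertia_def galois_id residually_equal_def)
  have \<Phi>_W: "\<Phi> \<in> W" using P.frobenius_weil_set[OF frob] W by simp
  \<comment> \<open>This writes \<Phi> in the shape to which the formulas for \<omega> and \<rho>
    apply, with k = 1 and trivial inertial part.\<close>
  have \<Phi>_eq: "\<Phi> = \<Phi> [^]\<^bsub>weil_group nrmp F\<^esub> (1::int) \<circ> id"
    using int_pow_int[of "weil_group nrmp F" \<Phi> 1] by (simp add: weil_group_nat_pow del: int_pow_int)
  have \<omega>_\<Phi>: "\<omega> \<Phi> = inverse (of_nat q)"
    using \<omega>_pow[OF id_inertia, of 1] unfolding \<Phi>_eq[symmetric] by (simp add: power_int_minus)
  \<comment> \<open>The cardinality \<open>q\<close> would be 0 for an infinite residue field. Then
    \<omega> \<Phi>, the inverse of \<open>q\<close>, would be 0 as well, which a character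
    excludes.\<close>
  have "\<omega> \<Phi> \<noteq> 0" using assms(12) \<Phi>_W W by (simp add: weil_character_def)
  then have q0: "q > 0" using \<omega>_\<Phi> by (cases q) auto
  have "is_subfield F" using assms(6) by (simp add: finite_extension_def)
  then have q1: "q > 1"
    using q0 P.residue_order_neq_1[of F] is_subfield_0[of F] is_subfield_1[of F] assms(7) by force
  have t_id: "t id = 0"
  proof -
    have "t (id \<circ> id) = t id + t id" using tame id_inertia unfolding tame_hom_def by blast
    then show ?thesis by simp
  qed

  define u where "u = \<omega> \<Phi>"
  define X where "X g = chi g * \<omega> g" for g
  define Y where "Y g = \<rho> g $ 1 $ 2" for g
  have decomp: "\<exists>k \<tau>. \<tau> \<in> inertia nrmp F \<and> g = \<Phi> [^]\<^bsub>weil_group nrmp F\<^esub> (k::int) \<circ> \<tau>"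
    if "g \<in> W" for g
    using P.weil_set_decomposition[OF frob] q0 that unfolding W assms(7) by metis
  have \<rho>: "\<rho> g = mat2 (X g) (Y g) 0 (chi g)" if "g \<in> W" for g
    using decomp[OF that] \<rho>_formula by (force simp: X_def Y_def)
  have \<rho>_GL: "mat2 (X g) (Y g) 0 (chi g) \<in> GL_over ?O" if "g \<in> W" for g
    using GL \<rho>[OF that] that by auto
  have chi_unit: "chi g \<in> K \<and> nrml (chi g) = 1" and X_unit: "X g \<in> K \<and> nrml (X g) = 1"
    and Y_int: "Y g \<in> ?O" if "g \<in> W" for g
  proof -
    have "X g \<in> ?O \<and> Y g \<in> ?O \<and> chi g \<in> ?O"
      using \<rho>_GL[OF that] by (force simp: GL_over_def forall_2)
    then show "chi g \<in> K \<and> nrml (chi g) = 1" "X g \<in> K \<and> nrml (X g) = 1" "Y g \<in> ?O"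
      using GL_over_triangular_unit[OF \<rho>_GL[OF that]]
      unfolding L.unit_integers_iff[symmetric] by (auto simp: unit_integers_def)
  qed
  have chi_int: "chi g \<in> ?O" and X_int: "X g \<in> ?O" if "g \<in> W" for g
    using chi_unit[OF that] X_unit[OF that] by (auto simp: integers_def)
  have nrm_u: "nrml u = 1"
    using chi_unit[OF \<Phi>_W] X_unit[OF \<Phi>_W] by (simp add: X_def u_def L.nrm_mult)
  have nrm_1_u: "nrml (1 - u) = nrml (of_nat q - 1)"
  proof -
    have "1 - u = u * (of_nat q - 1)"
      using q0 by (simp add: u_def \<omega>_\<Phi> field_simps)
    then show ?thesis by (simp add: L.nrm_mult nrm_u)
  qed
  \<comment> \<open>As \<omega> is trivial on inertia, each of its values is an integral power of
    the unit \<open>u\<close>.\<close>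
  have \<omega>_le: "nrml (1 - \<omega> g) \<le> nrml (1 - u)" if g: "g \<in> W" for g
  proof -
    obtain k \<tau> where "\<tau> \<in> inertia nrmp F" "g = \<Phi> [^]\<^bsub>weil_group nrmp F\<^esub> (k::int) \<circ> \<tau>"
      using decomp[OF g] by blast
    then have "\<omega> g = u powi k"
      using \<omega>_pow by (simp add: u_def \<omega>_\<Phi> power_int_minus power_int_inverse)
    then show ?thesis using L.nrm_one_minus_power_int_le[OF nrm_u] by simp
  qed
  have chi_X: "nrml (chi g - X g) = nrml (1 - \<omega> g)" if "g \<in> W" for g
  proof -
    have "chi g - X g = chi g * (1 - \<omega> g)" by (simp add: X_def algebra_simps)
    then show ?thesis using chi_unit[OF that] by (simp add: L.nrm_mult)
  qed
  \<comment> \<open>At \<Phi> the term with \<open>a / d\<close> vanishes because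
    \<open>t id = 0\<close>, so \<open>b / d\<close> can be read off from this entry.\<close>
  have Y_\<Phi>: "Y \<Phi> = b / d * (chi \<Phi> - X \<Phi>)"
    using \<rho>_formula[OF id_inertia \<Phi>_eq] by (simp add: Y_def X_def t_id)
  have nrm_Y_\<Phi>: "nrml (Y \<Phi>) = nrml (b / d * (1 - u))"
    unfolding Y_\<Phi> L.nrm_mult chi_X[OF \<Phi>_W] u_def ..
  have t_integral: "t \<tau> \<in> ?O" if "\<tau> \<in> inertia nrmp F" for \<tau>
    using tame that L.padic_subset by (auto simp: tame_hom_def integers_def)

  have \<rho>bar: "\<rho>bar g = mat2 (red (X g)) (red (Y g)) 0 (red (chi g))" if "g \<in> W" for g
    using reduce_rep_mat2[of \<rho> g, OF \<rho>[OF that], of red] L.red_eq_0_iff[OF red, of 0]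
      is_subfield_0[OF L.subfield_K]
    by (simp add: assms(26) integers_def)
  have sumbar: "sumbar = char_sum (\<lambda>g. red (X g)) (\<lambda>g. red (chi g))"
    by (simp add: assms(27) X_def)

  \<comment> \<open>The difference is \<open>a / d\<close> times the integer
    \<open>t \<tau> * X g\<close>.\<close>
  have Y_cong: "nrml (Y g - b / d * (chi g - X g)) < 1"
    if small: "a / d \<in> max_ideal nrml K" and g: "g \<in> W" for g
  proof -
    obtain k \<tau> where \<tau>: "\<tau> \<in> inertia nrmp F" "g = \<Phi> [^]\<^bsub>weil_group nrmp F\<^esub> (k::int) \<circ> \<tau>"
      using decomp[OF g] by blast
    have eq: "Y g - b / d * (chi g - X g) = (t \<tau> * X g) * (a / d)"
      using \<rho>_formula[OF \<tau>] by (simp add: Y_def X_def)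
    have "nrml (t \<tau> * X g) \<le> 1"
      using L.integers_closed(3)[OF t_integral[OF \<tau>(1)] X_int[OF g]] by (simp add: integers_def)
    then show ?thesis
      unfolding eq using small by (intro L.nrm_mult_less) (simp_all add: max_ideal_def)
  qed

  have part1: "\<not> decomposable_rep W \<rho>bar" if unit: "a / d \<in> unit_integers nrml K"
  proof -
    have "1 \<in> integers nrml (padic_numbers nrml)"
      by (simp add: integers_def is_subfield_1[OF L.subfield_padic])
    then have "1 \<in> t ` inertia nrmp F"
      using tame unfolding tame_hom_def by simp
    \<comment> \<open>Surjectivity of \<open>t\<close> onto the l-adic integers supplies this
      element. There \<omega> is 1, so the reduced diagonal is scalar while the corner is a
      unit.\<close>
    then obtain \<tau> where \<tau>: "\<tau> \<in> inertia nrmp F" "t \<tau> = 1" by force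
    have \<tau>_eq: "\<tau> = \<Phi> [^]\<^bsub>weil_group nrmp F\<^esub> (0::int) \<circ> \<tau>" by (simp add: int_pow_def2)
    have \<tau>_W: "\<tau> \<in> W" using \<tau>(1) inertia_subset_weil_set W by blast
    have "\<omega> \<tau> = 1" using \<omega>_pow[OF \<tau>(1), of 0] unfolding \<tau>_eq[symmetric] by simp
    then have X\<tau>: "X \<tau> = chi \<tau>" and Y\<tau>: "Y \<tau> = a / d * chi \<tau>"
      using \<rho>_formula[OF \<tau>(1) \<tau>_eq] \<tau>(2) by (simp_all add: X_def Y_def)
    have "nrml (Y \<tau>) = 1"
      using unit chi_unit[OF \<tau>_W] unfolding Y\<tau> L.unit_integers_iff L.nrm_mult by simp
    then have "red (Y \<tau>) \<noteq> 0" using L.red_eq_0_iff[OF red Y_int[OF \<tau>_W]] by simp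
    then show ?thesis
      using not_decomposable_unipotent[OF \<tau>_W, of \<rho>bar] \<rho>bar[OF \<tau>_W] X\<tau> by simp
  qed

  have part2: "isomorphic_reps W \<rho>bar sumbar"
    if q: "\<not> [q = 1] (mod l)" and small: "a / d \<in> max_ideal nrml K"
  proof -
    \<comment> \<open>Since 1 - u is not small, integrality of \<open>Y \<Phi>\<close> bounds
      \<open>b / d\<close> itself, and only then can \<open>b / d\<close> be reduced.\<close>
    have "nrml (of_nat q - 1) \<ge> 1" using q L.nrm_pred_less_1_iff[OF q0] by simp
    moreover have "nrml (b / d) * nrml (1 - u) \<le> 1"
      using Y_int[OF \<Phi>_W] nrm_Y_\<Phi> unfolding L.nrm_mult by (simp add: integers_def)
    ultimately have "nrml (b / d) \<le> 1"
      using mult_left_mono[of 1 "nrml (1 - u)" "nrml (b / d)"] L.nrm_nonneg[of "b / d"] nrm_1_u by simp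
    then have bd_int: "b / d \<in> ?O" using bd by (simp add: integers_def)
    have "red (Y g) = red (b / d) * (red (chi g) - red (X g))" if g: "g \<in> W" for g
    proof -
      have diff: "chi g - X g \<in> ?O" using L.integers_closed(2) chi_int[OF g] X_int[OF g] .
      have "red (Y g) = red (b / d * (chi g - X g))"
        using L.red_eq_iff[OF red Y_int[OF g] L.integers_closed(3)[OF bd_int diff]]
          Y_cong[OF small g] by simp
      also have "\<dots> = red (b / d) * red (chi g - X g)"
        using red bd_int diff by (auto simp: reduction_map_def)
      finally show ?thesis using L.red_diff[OF red chi_int[OF g] X_int[OF g]] by simp
    qed
    then show ?thesis
      unfolding sumbar using \<rho>bar by (intro isomorphic_triangular_char_sum) simp
  qed

  have part3: "(decomposable_rep W \<rho>bar \<longleftrightarrow> nrml (b / d * (1 - u)) < 1) \<and>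
      (isomorphic_reps W \<rho>bar sumbar \<longleftrightarrow> nrml (b / d * (1 - u)) < 1)"
    if q: "[q = 1] (mod l)" and small: "a / d \<in> max_ideal nrml K"
  proof -
    have "nrml (1 - u) < 1" using q L.nrm_pred_less_1_iff[OF q0] nrm_1_u by simp
    then have "nrml (chi g - X g) < 1" if "g \<in> W" for g
      using chi_X[OF that] \<omega>_le[OF that] by simp
    then have red_X: "red (X g) = red (chi g)" if "g \<in> W" for g
      using L.red_eq_iff[OF red chi_int[OF that] X_int[OF that]] that by simp
    show ?thesis
    proof (cases "nrml (b / d * (1 - u)) < 1")
      case True
      \<comment> \<open>The value at \<Phi> controls all others: chi g - X g is at most as large as
        1 - u.\<close>
      have Y0: "red (Y g) = 0" if g: "g \<in> W" for g
      proof -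
        have "nrml (b / d * (chi g - X g)) \<le> nrml (b / d * (1 - u))"
          unfolding L.nrm_mult using \<omega>_le[OF g] chi_X[OF g] L.nrm_nonneg
          by (intro mult_left_mono) auto
        then have "nrml (Y g) < 1"
          using L.nrm_add_less[OF Y_cong[OF small g], of "b / d * (chi g - X g)"] True by simp
        then show ?thesis using L.red_eq_0_iff[OF red Y_int[OF g]] by simp
      qed
      have "decomposable_rep W \<rho>bar"
        using \<rho>bar Y0 by (intro decomposable_char_sum) auto
      moreover have "isomorphic_reps W \<rho>bar sumbar"
        unfolding sumbar
        using \<rho>bar Y0 by (intro isomorphic_triangular_char_sum[where c = 0]) auto
      ultimately show ?thesis using True by simp
    next
      case False
      \<comment> \<open>In this case \<Phi> itself reduces to a non-diagonal matrix with scalar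
        diagonal, which excludes both a decomposition and an isomorphism with the sum of
        characters.\<close>
      then have Y\<Phi>: "red (Y \<Phi>) \<noteq> 0"
        using L.red_eq_0_iff[OF red Y_int[OF \<Phi>_W]] nrm_Y_\<Phi> by simp
      have \<rho>bar_\<Phi>: "\<rho>bar \<Phi> = mat2 (red (chi \<Phi>)) (red (Y \<Phi>)) 0 (red (chi \<Phi>))"
        using \<rho>bar[OF \<Phi>_W] red_X[OF \<Phi>_W] by simp
      have "\<not> decomposable_rep W \<rho>bar"
        by (rule not_decomposable_unipotent[of \<Phi> W \<rho>bar, OF \<Phi>_W \<rho>bar_\<Phi> Y\<Phi>])
      moreover have "\<not> isomorphic_reps W \<rho>bar sumbar"
        unfolding sumbar
        using isomorphic_char_sum_scalar[of W \<rho>bar "\<lambda>g. red (X g)" "\<lambda>g. red (chi g)" \<Phi>]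
          \<Phi>_W \<rho>bar_\<Phi> red_X[OF \<Phi>_W] Y\<Phi> by blast
      ultimately show ?thesis using False by simp
    qed
  qed

  \<comment> \<open>Here |1 - u| = |q - 1| = |l^i|, so the criterion at \<Phi> becomes the bound on
    the normalized valuation.\<close>
  have "nrml (b / d * (1 - u)) < 1 \<longleftrightarrow>
      normalized_val nrml K (b / d) \<ge> ereal (1 - real e * real i)"
    unfolding assms(28) L.normalized_val_ge_iff[OF bd] assms(29)
    unfolding L.nrm_mult nrm_1_u L.nrm_pred_eq_prime_power[OF q1] L.nrm_power ..
  moreover have "reducible_rep W \<rho>bar"
    by (rule reducible_triangular) (rule \<rho>bar)
  ultimately show ?thesis using part1 part2 part3 by blast
qed

end
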